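(* Let $(\underline\Sigma,\Sigma_{\mathbb Z},\Sigma'_{\mathbb Z},\Phi)$ be an $\mathbb F_1$-scheme with relations such that the underlying $\widetilde{\mathsf B}$-scheme $\Sigma$ is noetherian and torsion-free. Set $$Q(\underline\Sigma,n)=\sum_{x\in\underline\Sigma}\#\operatorname{Hom}_{\mathsf B}(\mathcal O_{\Sigma,x}^\times,\mathbb F_{1^n}),\qquad P(\underline\Sigma,n)=\sum_{x\in\underline\Sigma}\#\operatorname{Hom}(\mathcal O_{\underline\Sigma,x}^\times,\mathbb F_{1^n}).$$ Then $Q(\underline\Sigma,n)\le P(\underline\Sigma,n)$ for every integer $n\ge1$.
   Context: Monoids ($\mathsf{Mon}_0$) are commutative, multiplicative, with $1$ and absorbing element $0$; $|\cdot|:\mathsf{Ring}\to\mathsf{Mon}_0$ forgets addition, with left adjoint $A\mapsto A\otimes_{\mathbb F_1}\mathbb Z$. A monoidal scheme is a scheme over pointed sets (with smash product) in the sense of Toën–Vaquié; equivalently, a topological space with a sheaf of monoids locally isomorphic to the prime spectrum $\operatorname{Spec}A$ of a monoid $A$, with stalks the localizations $A_{\mathfrak p}$. It is noetherian if it has a finite open cover by spectra of noetherian (equivalently finitely generated) monoids. $\widetilde{\mathsf B}$-schemes (with ring relations). $\mathbb Z\text{-}\widetilde{\mathsf{Blp}}$ is the category of pairs $(A,A\otimes_{\mathbb F_1}\mathbb Z\to R)$, $A\in\mathsf{Mon}_0$, $R$ a commutative ring, with surjective ring map (the commutative monoid objects in the symmetric monoidal category of pairs $(X,\mathbb Z[X]\to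 M)$, $X$ a pointed set, $M$ an abelian group, the map surjective, with componentwise product $\wedge$, $\otimes_{\mathbb Z}$); $\mathbb Z\text{-}\mathsf{Blp}$ is the full subcategory where $A\to|R|$ is injective. A $\widetilde{\mathsf B}$-scheme is a Toën–Vaquié scheme relative to $\mathbb Z\text{-}\widetilde{\mathsf{Blp}}$ (a Zariski sheaf on $(\mathbb Z\text{-}\widetilde{\mathsf{Blp}})^{op}$ with an affine Zariski cover) that admits a Zariski cover by affine schemes from $\mathbb Z\text{-}\mathsf{Blp}$. The functors $(A,R)\mapsto A$, $(A,R)\mapsto R$ extend to schemes and give a monoidal scheme $\underline\Sigma$ and a classical scheme $\Sigma_{\mathbb Z}$. An $\mathbb F_1$-scheme (Connes–Consani) is a triple $(\underline\Xi,\Xi_{\mathbb Z},\Phi)$ of a monoidal scheme, a classical scheme and a natural transformation $\Phi:\underline\Xi\to\Xi_{\mathbb Z}\circ(-\otimes_{\mathbb F_1}\mathbb Z)$ whose adjoint $\underline\Xi\circ|\cdot|\to\Xi_{\mathbb Z}$ is bijective on fields. An $\mathbb F_1$-scheme with relations $(\underline\Sigma,\Sigma_{\mathbb Z},\Sigma'_{\mathbb Z},\Phi)$ consists of a $\widetilde{\mathsf B}$-scheme $\Sigma$ giving $(\underline\Sigma,\Sigma_{\mathbb Z})$ and an $\mathbb F_1$-scheme $(\underline\Sigma,\Sigma'_{\mathbb Z},\Phi)$ with the same $\underline\Sigma$. Points and homs. Sums over $x\in\underline\Sigma$ run over the points of the topological space of $\underline\Sigma$. $\mathcal O_{\underline\Sigma,x}^\times$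 is the group of units of the stalk $\mathcal O_{\underline\Sigma,x}=A_{\mathfrak p}$. For an abelian group $G$ (multiplicative, with an absorbing element $0$ adjoined), $\operatorname{Hom}_{\mathsf B}(\mathcal O_{\Sigma,x}^\times,G)$ is the subset of $\operatorname{Hom}(\mathcal O_{\underline\Sigma,x}^\times,G)$ of those morphisms satisfying the relations encoded in the blueprint structure of $\Sigma$ at $x$: if $\Sigma$ is given near $x$ by $(A,A\otimes_{\mathbb F_1}\mathbb Z\to R)$ and $x$ corresponds to the prime $\mathfrak p$, then the extension of the morphism by $0$ on non-units, $A_{\mathfrak p}\to G\cup\{0\}$, must induce a ring map $A_{\mathfrak p}\otimes_{\mathbb F_1}\mathbb Z\to(G\cup\{0\})\otimes_{\mathbb F_1}\mathbb Z$ factoring through the localization $R_{\mathfrak p}$ of $R$ at the image of $A\setminus\mathfrak p$. $\mathbb F_{1^n}=\{0\}\cup\mu_n$, with $\mu_n$ cyclic of order $n$. $\Sigma$ is noetherian if $\underline\Sigma$ is noetherian; a noetherian $\Sigma$ is torsion-free if for every point $x$ and every finite abelian group $G$ the number $\#\operatorname{Hom}_{\mathsf B}(\mathcal O_{\Sigma,x}^\times,G)$ is polynomial in $\#G$. *)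

theory Defs
  imports
    "HOL-Algebra.Module"
    "HOL-Algebra.Ideal"
    "HOL-Library.Poly_Mapping"
    "HOL-Analysis.Abstract_Topology"
    "HOL-Computational_Algebra.Polynomial"
begin

text \<open>
  Size convention: the categories of monoids, rings and pairs over which functors of points
  are taken have objects whose carriers are subsets of a type \<open>'u\<close>. This type plays the
  role of the universe; it is assumed infinite in the final statement, so that it is closed
  under localizations, monoid rings, tensor products, etc.
\<close>

section \<open>Categories, set-valued functors, sites and relative schemes\<close>

text \<open>\<open>cmp C A g f\<close> is the composite \<open>g \<circ> f\<close> of arrows where \<open>f\<close> has source \<open>A\<close>.\<close>

record ('o, 'a) category =
  obj :: "'o set"
  arr :: "'o \<Rightarrow> 'o \<Rightarrow> 'a set"
  cmp :: "'o \<Rightarrow> 'a \<Rightarrow> 'a \<Rightarrow> 'a"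
  idt :: "'o \<Rightarrow> 'a"

definition is_category :: "('o, 'a, 'z) category_scheme \<Rightarrow> bool" where
  "is_category C \<longleftrightarrow>
     (\<forall>A\<in>obj C. idt C A \<in> arr C A A) \<and>
     (\<forall>A\<in>obj C. \<forall>B\<in>obj C. \<forall>D\<in>obj C. \<forall>f\<in>arr C A B. \<forall>g\<in>arr C B D. cmp C A g f \<in> arr C A D) \<and>
     (\<forall>A\<in>obj C. \<forall>B\<in>obj C. \<forall>f\<in>arr C A B. cmp C A f (idt C A) = f \<and> cmp C A (idt C B) f = f) \<and>
     (\<forall>A\<in>obj C. \<forall>B\<in>obj C. \<forall>D\<in>obj C. \<forall>E\<in>obj C. \<forall>f\<in>arr C A B. \<forall>g\<in>arr C B D. \<forall>h\<in>arr C D E.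
        cmp C A h (cmp C A g f) = cmp C A (cmp C B h g) f)"

definition is_iso :: "('o, 'a, 'z) category_scheme \<Rightarrow> 'o \<Rightarrow> 'o \<Rightarrow> 'a \<Rightarrow> bool" where
  "is_iso C A B f \<longleftrightarrow> f \<in> arr C A B \<and>
     (\<exists>g\<in>arr C B A. cmp C A g f = idt C A \<and> cmp C B f g = idt C B)"

definition is_epi :: "('o, 'a, 'z) category_scheme \<Rightarrow> 'o \<Rightarrow> 'o \<Rightarrow> 'a \<Rightarrow> bool" where
  "is_epi C A B f \<longleftrightarrow> f \<in> arr C A B \<and>
     (\<forall>D\<in>obj C. \<forall>g\<in>arr C B D. \<forall>h\<in>arr C B D. cmp C A g f = cmp C A h f \<longrightarrow> g = h)"

definition is_terminal :: "('o, 'a, 'z) category_scheme \<Rightarrow> 'o \<Rightarrow> bool" where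
  "is_terminal C T \<longleftrightarrow> T \<in> obj C \<and> (\<forall>A\<in>obj C. \<exists>!f. f \<in> arr C A T)"

definition is_pullback ::
  "('o, 'a, 'z) category_scheme \<Rightarrow> 'o \<Rightarrow> 'o \<Rightarrow> 'o \<Rightarrow> 'o \<Rightarrow> 'a \<Rightarrow> 'a \<Rightarrow> 'a \<Rightarrow> 'a \<Rightarrow> bool" where
  "is_pullback C P A B Z p q f g \<longleftrightarrow>
     P \<in> obj C \<and> A \<in> obj C \<and> B \<in> obj C \<and> Z \<in> obj C \<and>
     p \<in> arr C P A \<and> q \<in> arr C P B \<and> f \<in> arr C A Z \<and> g \<in> arr C B Z \<and>
     cmp C P f p = cmp C P g q \<and>
     (\<forall>T\<in>obj C. \<forall>a\<in>arr C T A. \<forall>b\<in>arr C T B. cmp C T f a = cmp C T g b \<longrightarrow>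
        (\<exists>!t. t \<in> arr C T P \<and> cmp C T p t = a \<and> cmp C T q t = b))"

definition under_category :: "('o, 'a, 'z) category_scheme \<Rightarrow> 'o \<Rightarrow> ('o \<times> 'a, 'a) category" where
  "under_category C A = \<lparr>
     obj = {(B, \<phi>). B \<in> obj C \<and> \<phi> \<in> arr C A B},
     arr = (\<lambda>(B, \<phi>) (D, \<psi>). {f \<in> arr C B D. cmp C A f \<phi> = \<psi>}),
     cmp = (\<lambda>X. cmp C (fst X)),
     idt = (\<lambda>X. idt C (fst X))\<rparr>"

definition is_filtered :: "('i, 'j, 'z) category_scheme \<Rightarrow> bool" where
  "is_filtered I \<longleftrightarrow> is_category I \<and> obj I \<noteq> {} \<and>
     (\<forall>i\<in>obj I. \<forall>j\<in>obj I. \<exists>k\<in>obj I. arr I i k \<noteq> {} \<and> arr I j k \<noteq> {}) \<and>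
     (\<forall>i\<in>obj I. \<forall>j\<in>obj I. \<forall>u\<in>arr I i j. \<forall>v\<in>arr I i j.
        \<exists>k\<in>obj I. \<exists>w\<in>arr I j k. cmp I i w u = cmp I i w v)"

definition is_diagram :: "('i, 'j, 'y) category_scheme \<Rightarrow> ('o, 'a, 'z) category_scheme \<Rightarrow>
    ('i \<Rightarrow> 'o) \<Rightarrow> ('i \<Rightarrow> 'i \<Rightarrow> 'j \<Rightarrow> 'a) \<Rightarrow> bool" where
  "is_diagram I C D d \<longleftrightarrow>
     (\<forall>i\<in>obj I. D i \<in> obj C \<and> d i i (idt I i) = idt C (D i)) \<and>
     (\<forall>i\<in>obj I. \<forall>j\<in>obj I. \<forall>u\<in>arr I i j. d i j u \<in> arr C (D i) (D j)) \<and>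
     (\<forall>i\<in>obj I. \<forall>j\<in>obj I. \<forall>k\<in>obj I. \<forall>u\<in>arr I i j. \<forall>v\<in>arr I j k.
        d i k (cmp I i v u) = cmp C (D i) (d j k v) (d i j u))"

definition is_cocone :: "('i, 'j, 'y) category_scheme \<Rightarrow> ('o, 'a, 'z) category_scheme \<Rightarrow>
    ('i \<Rightarrow> 'o) \<Rightarrow> ('i \<Rightarrow> 'i \<Rightarrow> 'j \<Rightarrow> 'a) \<Rightarrow> 'o \<Rightarrow> ('i \<Rightarrow> 'a) \<Rightarrow> bool" where
  "is_cocone I C D d L c \<longleftrightarrow> L \<in> obj C \<and> (\<forall>i\<in>obj I. c i \<in> arr C (D i) L) \<and>
     (\<forall>i\<in>obj I. \<forall>j\<in>obj I. \<forall>u\<in>arr I i j. cmp C (D i) (c j) (d i j u) = c i)"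

definition is_colimit :: "('i, 'j, 'y) category_scheme \<Rightarrow> ('o, 'a, 'z) category_scheme \<Rightarrow>
    ('i \<Rightarrow> 'o) \<Rightarrow> ('i \<Rightarrow> 'i \<Rightarrow> 'j \<Rightarrow> 'a) \<Rightarrow> 'o \<Rightarrow> ('i \<Rightarrow> 'a) \<Rightarrow> bool" where
  "is_colimit I C D d L c \<longleftrightarrow> is_cocone I C D d L c \<and>
     (\<forall>T b. is_cocone I C D d T b \<longrightarrow>
        (\<exists>!t. t \<in> arr C L T \<and> (\<forall>i\<in>obj I. cmp C (D i) t (c i) = b i)))"

text \<open>Covariant set-valued functors; a presheaf on \<open>C\<^sup>o\<^sup>p\<close> is such a functor on \<open>C\<close>.\<close>

record ('o, 'a, 'p) set_functor =
  val :: "'o \<Rightarrow> 'p set"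
  act :: "'o \<Rightarrow> 'o \<Rightarrow> 'a \<Rightarrow> 'p \<Rightarrow> 'p"

definition is_set_functor ::
  "('o, 'a, 'z) category_scheme \<Rightarrow> ('o, 'a, 'p) set_functor \<Rightarrow> bool" where
  "is_set_functor C F \<longleftrightarrow>
     (\<forall>A\<in>obj C. \<forall>s\<in>val F A. act F A A (idt C A) s = s) \<and>
     (\<forall>A\<in>obj C. \<forall>B\<in>obj C. \<forall>f\<in>arr C A B. act F A B f \<in> val F A \<rightarrow> val F B) \<and>
     (\<forall>A\<in>obj C. \<forall>B\<in>obj C. \<forall>D\<in>obj C. \<forall>f\<in>arr C A B. \<forall>g\<in>arr C B D. \<forall>s\<in>val F A.
        act F A D (cmp C A g f) s = act F B D g (act F A B f s))"

definition is_natural :: "('o, 'a, 'z) category_scheme \<Rightarrow> ('o, 'a, 'p) set_functor \<Rightarrow>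
    ('o, 'a, 'q) set_functor \<Rightarrow> ('o \<Rightarrow> 'p \<Rightarrow> 'q) \<Rightarrow> bool" where
  "is_natural C F G t \<longleftrightarrow>
     (\<forall>A\<in>obj C. t A \<in> val F A \<rightarrow> val G A) \<and>
     (\<forall>A\<in>obj C. \<forall>B\<in>obj C. \<forall>f\<in>arr C A B. \<forall>s\<in>val F A.
        t B (act F A B f s) = act G A B f (t A s))"

definition precompose :: "('c \<Rightarrow> 'o) \<Rightarrow> ('c \<Rightarrow> 'c \<Rightarrow> 'b \<Rightarrow> 'a) \<Rightarrow>
    ('o, 'a, 'p) set_functor \<Rightarrow> ('c, 'b, 'p) set_functor" where
  "precompose D d F = \<lparr>val = (\<lambda>A. val F (D A)), act = (\<lambda>A B f. act F (D A) (D B) (d A B f))\<rparr>"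

text \<open>
  A category of commutative monoid objects together with the arrows \<open>A \<rightarrow> B\<close> for which
  \<open>Spec B \<rightarrow> Spec A\<close> is an affine Zariski open, and the Zariski covering families of
  \<open>Spec A\<close>, given as sets of pairs \<open>(B, A \<rightarrow> B)\<close>.
\<close>

record ('o, 'a) site = "('o, 'a) category" +
  opn :: "'o \<Rightarrow> 'o \<Rightarrow> 'a \<Rightarrow> bool"
  cov :: "'o \<Rightarrow> ('o \<times> 'a) set \<Rightarrow> bool"

definition is_sheaf :: "('o, 'a) site \<Rightarrow> ('o, 'a, 'p) set_functor \<Rightarrow> bool" where
  "is_sheaf C F \<longleftrightarrow> is_set_functor C F \<and>
     (\<forall>A\<in>obj C. \<forall>K. cov C A K \<longrightarrow>
       (\<forall>s. (\<forall>k\<in>K. s k \<in> val F (fst k)) \<and>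
            (\<forall>(B, \<phi>)\<in>K. \<forall>(B', \<phi>')\<in>K. \<forall>D\<in>obj C. \<forall>\<beta>\<in>arr C B D. \<forall>\<beta>'\<in>arr C B' D.
               cmp C A \<beta> \<phi> = cmp C A \<beta>' \<phi>' \<longrightarrow>
               act F B D \<beta> (s (B, \<phi>)) = act F B' D \<beta>' (s (B', \<phi>'))) \<longrightarrow>
          (\<exists>!t. t \<in> val F A \<and> (\<forall>(B, \<phi>)\<in>K. act F A B \<phi> t = s (B, \<phi>)))))"

text \<open>
  By the Yoneda lemma, \<open>u \<in> F(A)\<close> is a morphism \<open>Spec A \<rightarrow> F\<close>. It is a Zariski open immersion
  if for every \<open>c : Spec B \<rightarrow> F\<close> the base change \<open>Spec A \<times>\<^sub>F Spec B \<rightarrow> Spec B\<close> is a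
  monomorphism whose image is the image sheaf of a family \<open>W\<close> of affine Zariski opens of \<open>Spec B\<close>.
\<close>

definition zariski_open_immersion ::
  "('o, 'a) site \<Rightarrow> ('o, 'a, 'p) set_functor \<Rightarrow> 'o \<Rightarrow> 'p \<Rightarrow> bool" where
  "zariski_open_immersion C F A u \<longleftrightarrow> A \<in> obj C \<and> u \<in> val F A \<and>
     (\<forall>B\<in>obj C. \<forall>c\<in>val F B.
        (\<forall>D\<in>obj C. \<forall>\<gamma>\<in>arr C B D. \<forall>\<alpha>\<in>arr C A D. \<forall>\<alpha>'\<in>arr C A D.
           act F A D \<alpha> u = act F B D \<gamma> c \<and> act F A D \<alpha>' u = act F B D \<gamma> c \<longrightarrow> \<alpha> = \<alpha>') \<and>
        (\<exists>W. (\<forall>(E, \<omega>)\<in>W. E \<in> obj C \<and> \<omega> \<in> arr C B E \<and> opn C B E \<omega>) \<and>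
           (\<forall>D\<in>obj C. \<forall>\<gamma>\<in>arr C B D.
              (\<exists>\<alpha>\<in>arr C A D. act F A D \<alpha> u = act F B D \<gamma> c) \<longleftrightarrow>
              (\<exists>K. cov C D K \<and> (\<forall>(D', \<delta>)\<in>K. \<exists>(E, \<omega>)\<in>W. \<exists>\<kappa>\<in>arr C E D'.
                 cmp C B \<kappa> \<omega> = cmp C B \<delta> \<gamma>)))))"

definition affine_zariski_cover ::
  "('o, 'a) site \<Rightarrow> ('o, 'a, 'p) set_functor \<Rightarrow> ('o \<times> 'p) set \<Rightarrow> bool" where
  "affine_zariski_cover C F U \<longleftrightarrow>
     (\<forall>(A, u)\<in>U. zariski_open_immersion C F A u) \<and>
     (\<forall>B\<in>obj C. \<forall>c\<in>val F B. \<exists>K. cov C B K \<and>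
        (\<forall>(D, \<gamma>)\<in>K. \<exists>(A, u)\<in>U. \<exists>\<alpha>\<in>arr C A D. act F A D \<alpha> u = act F B D \<gamma> c))"

definition is_scheme :: "('o, 'a) site \<Rightarrow> ('o, 'a, 'p) set_functor \<Rightarrow> bool" where
  "is_scheme C F \<longleftrightarrow> is_sheaf C F \<and> (\<exists>U. affine_zariski_cover C F U)"

text \<open>\<open>t : F \<rightarrow> G\<close> exhibits \<open>G\<close> as the associated sheaf of the presheaf \<open>F\<close>.\<close>

definition is_sheafification :: "('o, 'a) site \<Rightarrow> ('o, 'a, 'p) set_functor \<Rightarrow>
    ('o, 'a, 'q) set_functor \<Rightarrow> ('o \<Rightarrow> 'p \<Rightarrow> 'q) \<Rightarrow> bool" where
  "is_sheafification C F G t \<longleftrightarrow> is_set_functor C F \<and> is_sheaf C G \<and> is_natural C F G t \<and>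
     (\<forall>A\<in>obj C. \<forall>s\<in>val F A. \<forall>s'\<in>val F A. t A s = t A s' \<longrightarrow>
        (\<exists>K. cov C A K \<and> (\<forall>(B, \<phi>)\<in>K. act F A B \<phi> s = act F A B \<phi> s'))) \<and>
     (\<forall>A\<in>obj C. \<forall>g\<in>val G A.
        (\<exists>K. cov C A K \<and> (\<forall>(B, \<phi>)\<in>K. \<exists>s\<in>val F B. t B s = act G A B \<phi> g)))"


section \<open>Monoids with zero and monoid rings\<close>

record 'a mon0 = "'a monoid" +
  mzero :: 'a

definition is_mon0 :: "('a, 'z) mon0_scheme \<Rightarrow> bool" where
  "is_mon0 A \<longleftrightarrow> comm_monoid A \<and> mzero A \<in> carrier A \<and>
     (\<forall>a\<in>carrier A. mzero A \<otimes>\<^bsub>A\<^esub> a = mzero A)"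

definition hom0 :: "('a, 'y) mon0_scheme \<Rightarrow> ('b, 'z) mon0_scheme \<Rightarrow> ('a \<Rightarrow> 'b) set" where
  "hom0 A B = {f \<in> hom A B \<inter> extensional (carrier A). f \<one>\<^bsub>A\<^esub> = \<one>\<^bsub>B\<^esub> \<and> f (mzero A) = mzero B}"

definition Mon0 :: "('a mon0, 'a \<Rightarrow> 'a) category" where
  "Mon0 = \<lparr>obj = {A. is_mon0 A}, arr = hom0,
     cmp = (\<lambda>A. compose (carrier A)), idt = (\<lambda>A. \<lambda>a\<in>carrier A. a)\<rparr>"

definition fin_gen :: "'a mon0 \<Rightarrow> bool" where
  "fin_gen A \<longleftrightarrow> (\<exists>E. finite E \<and> E \<subseteq> carrier A \<and>
     (\<forall>T. E \<subseteq> T \<and> \<one>\<^bsub>A\<^esub> \<in> T \<and> mzero A \<in> T \<and> (\<forall>a\<in>T. \<forall>b\<in>T. a \<otimes>\<^bsub>A\<^esub> b \<in> T) \<longrightarrow> carrier A \<subseteq> T))"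

text \<open>
  The free abelian group \<open>\<int>[X]\<close> on a pointed set \<open>(X, z)\<close> is the group of finitely supported
  functions on \<open>X - {z}\<close>; \<open>pdelta z x\<close> is the class of \<open>x\<close>, and \<open>pmap z' f\<close> is \<open>\<int>[f]\<close> for
  a pointed map \<open>f\<close> into a set with base point \<open>z'\<close>.
\<close>

definition pfree :: "'a set \<Rightarrow> 'a \<Rightarrow> ('a \<Rightarrow>\<^sub>0 int) set" where
  "pfree X z = {c. Poly_Mapping.keys c \<subseteq> X - {z}}"

definition pdelta :: "'a \<Rightarrow> 'a \<Rightarrow> ('a \<Rightarrow>\<^sub>0 int)" where
  "pdelta z x = (if x = z then 0 else frag_of x)"

definition pmap :: "'b \<Rightarrow> ('a \<Rightarrow> 'b) \<Rightarrow> ('a \<Rightarrow>\<^sub>0 int) \<Rightarrow> ('b \<Rightarrow>\<^sub>0 int)" where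
  "pmap z' f = frag_extend (\<lambda>x. pdelta z' (f x))"

text \<open>The ring \<open>A \<otimes>\<^bsub>\<bbbF>\<^sub>1\<^esub> \<int> = \<int>[A]/(0\<^sub>A)\<close>.\<close>

definition monoid_ring :: "('a, 'z) mon0_scheme \<Rightarrow> ('a \<Rightarrow>\<^sub>0 int) ring" where
  "monoid_ring A = \<lparr>
     carrier = pfree (carrier A) (mzero A),
     monoid.mult = (\<lambda>f g. frag_extend (\<lambda>x. frag_extend (\<lambda>y. pdelta (mzero A) (x \<otimes>\<^bsub>A\<^esub> y)) g) f),
     one = pdelta (mzero A) \<one>\<^bsub>A\<^esub>,
     zero = 0,
     add = (+)\<rparr>"

text \<open>The ring map \<open>A \<otimes>\<^bsub>\<bbbF>\<^sub>1\<^esub> \<int> \<rightarrow> R\<close> adjoint to \<open>e : A \<rightarrow> |R|\<close>.\<close>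

definition monoid_ring_lift ::
  "('b, 'z) ring_scheme \<Rightarrow> ('a \<Rightarrow> 'b) \<Rightarrow> ('a \<Rightarrow>\<^sub>0 int) \<Rightarrow> 'b" where
  "monoid_ring_lift R e c =
     finsum R (\<lambda>x. [Poly_Mapping.lookup c x] \<cdot>\<^bsub>R\<^esub> e x) (Poly_Mapping.keys c)"

definition forget :: "('a, 'z) ring_scheme \<Rightarrow> 'a mon0" where
  "forget R = \<lparr>carrier = carrier R, monoid.mult = monoid.mult R, one = one R, mzero = zero R\<rparr>"

definition Rng_hom :: "'a ring \<Rightarrow> 'b ring \<Rightarrow> ('a \<Rightarrow> 'b) set" where
  "Rng_hom R S = ring_hom R S \<inter> extensional (carrier R)"

text \<open>
  The functor \<open>- \<otimes>\<^bsub>\<bbbF>\<^sub>1\<^esub> \<int>\<close> with values in rings on \<open>'u\<close>: the monoid ring is transported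
  along a fixed injection, which exists as soon as \<open>'u\<close> is infinite.
\<close>

definition enc :: "('u \<Rightarrow>\<^sub>0 int) \<Rightarrow> 'u" where
  "enc = (SOME e. inj e)"

definition dec :: "'u \<Rightarrow> ('u \<Rightarrow>\<^sub>0 int)" where
  "dec = inv_into UNIV enc"

definition free_ring :: "'u mon0 \<Rightarrow> 'u ring" where
  "free_ring A = (let R = monoid_ring A in \<lparr>
     carrier = enc ` carrier R,
     monoid.mult = (\<lambda>x y. enc (dec x \<otimes>\<^bsub>R\<^esub> dec y)),
     one = enc \<one>\<^bsub>R\<^esub>,
     zero = enc \<zero>\<^bsub>R\<^esub>,
     add = (\<lambda>x y. enc (dec x \<oplus>\<^bsub>R\<^esub> dec y))\<rparr>)"

definition free_ring_map :: "'u mon0 \<Rightarrow> 'u mon0 \<Rightarrow> ('u \<Rightarrow> 'u) \<Rightarrow> ('u \<Rightarrow> 'u)" where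
  "free_ring_map A B f = (\<lambda>x\<in>carrier (free_ring A). enc (pmap (mzero B) f (dec x)))"

definition counit :: "'u ring \<Rightarrow> ('u \<Rightarrow> 'u)" where
  "counit R = (\<lambda>x\<in>carrier (free_ring (forget R)). monoid_ring_lift R (\<lambda>r. r) (dec x))"


section \<open>Localization\<close>

text \<open>
  \<open>frac A S a s\<close> is the class of \<open>a/s\<close> in the localization of \<open>A\<close> at the multiplicative subset
  \<open>S\<close>. The same relation serves for monoids and for rings.
\<close>

definition frac :: "('a, 'z) monoid_scheme \<Rightarrow> 'a set \<Rightarrow> 'a \<Rightarrow> 'a \<Rightarrow> ('a \<times> 'a) set" where
  "frac A S a s = {(b, t). b \<in> carrier A \<and> t \<in> S \<and>
     (\<exists>w\<in>S. w \<otimes>\<^bsub>A\<^esub> (t \<otimes>\<^bsub>A\<^esub> a) = w \<otimes>\<^bsub>A\<^esub> (s \<otimes>\<^bsub>A\<^esub> b))}"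

definition fracs :: "('a, 'z) monoid_scheme \<Rightarrow> 'a set \<Rightarrow> ('a \<times> 'a) set set" where
  "fracs A S = {frac A S a s | a s. a \<in> carrier A \<and> s \<in> S}"

definition frac_mult :: "('a, 'z) monoid_scheme \<Rightarrow> 'a set \<Rightarrow>
    ('a \<times> 'a) set \<Rightarrow> ('a \<times> 'a) set \<Rightarrow> ('a \<times> 'a) set" where
  "frac_mult A S c d = (\<Union>(a, s)\<in>c. \<Union>(b, t)\<in>d. frac A S (a \<otimes>\<^bsub>A\<^esub> b) (s \<otimes>\<^bsub>A\<^esub> t))"

definition mon_loc :: "('a, 'z) mon0_scheme \<Rightarrow> 'a set \<Rightarrow> ('a \<times> 'a) set mon0" where
  "mon_loc A S = \<lparr>carrier = fracs A S, monoid.mult = frac_mult A S,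
     one = frac A S \<one>\<^bsub>A\<^esub> \<one>\<^bsub>A\<^esub>, mzero = frac A S (mzero A) \<one>\<^bsub>A\<^esub>\<rparr>"

definition ring_loc :: "('a, 'z) ring_scheme \<Rightarrow> 'a set \<Rightarrow> ('a \<times> 'a) set ring" where
  "ring_loc R S = \<lparr>carrier = fracs R S, monoid.mult = frac_mult R S,
     one = frac R S \<one>\<^bsub>R\<^esub> \<one>\<^bsub>R\<^esub>, zero = frac R S \<zero>\<^bsub>R\<^esub> \<one>\<^bsub>R\<^esub>,
     add = (\<lambda>c d. \<Union>(a, s)\<in>c. \<Union>(b, t)\<in>d.
       frac R S ((t \<otimes>\<^bsub>R\<^esub> a) \<oplus>\<^bsub>R\<^esub> (s \<otimes>\<^bsub>R\<^esub> b)) (s \<otimes>\<^bsub>R\<^esub> t))\<rparr>"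

text \<open>The map \<open>A\<^sub>S \<rightarrow> B\<^sub>T\<close> induced by \<open>f : A \<rightarrow> B\<close> with \<open>f(S) \<subseteq> T\<close>.\<close>

definition loc_map :: "('b, 'z) monoid_scheme \<Rightarrow> 'b set \<Rightarrow> ('a \<Rightarrow> 'b) \<Rightarrow>
    ('a \<times> 'a) set \<Rightarrow> ('b \<times> 'b) set" where
  "loc_map B T f c = (\<Union>(a, s)\<in>c. frac B T (f a) (f s))"


section \<open>Monoidal spaces and monoidal schemes\<close>

record ('p, 's) mspace =
  mtop :: "'p topology"
  sec :: "'p set \<Rightarrow> 's mon0"
  res :: "'p set \<Rightarrow> 'p set \<Rightarrow> 's \<Rightarrow> 's"

definition germ :: "('p, 's) mspace \<Rightarrow> 'p \<Rightarrow> 'p set \<Rightarrow> 's \<Rightarrow> ('p set \<times> 's) set" where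
  "germ X x U s = {(V, t). openin (mtop X) V \<and> x \<in> V \<and> t \<in> carrier (sec X V) \<and>
     (\<exists>W. openin (mtop X) W \<and> x \<in> W \<and> W \<subseteq> U \<inter> V \<and> res X U W s = res X V W t)}"

definition stalk :: "('p, 's) mspace \<Rightarrow> 'p \<Rightarrow> ('p set \<times> 's) set mon0" where
  "stalk X x = \<lparr>
     carrier = {germ X x U s | U s. openin (mtop X) U \<and> x \<in> U \<and> s \<in> carrier (sec X U)},
     monoid.mult = (\<lambda>c d. \<Union>(U, s)\<in>c. \<Union>(V, t)\<in>d.
       germ X x (U \<inter> V) (res X U (U \<inter> V) s \<otimes>\<^bsub>sec X (U \<inter> V)\<^esub> res X V (U \<inter> V) t)),
     one = germ X x (topspace (mtop X)) \<one>\<^bsub>sec X (topspace (mtop X))\<^esub>,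
     mzero = germ X x (topspace (mtop X)) (mzero (sec X (topspace (mtop X))))\<rparr>"

definition is_mspace :: "('p, 's) mspace \<Rightarrow> bool" where
  "is_mspace X \<longleftrightarrow>
     (\<forall>U. openin (mtop X) U \<longrightarrow> is_mon0 (sec X U)) \<and>
     (\<forall>U V. openin (mtop X) U \<and> openin (mtop X) V \<and> V \<subseteq> U \<longrightarrow>
        restrict (res X U V) (carrier (sec X U)) \<in> hom0 (sec X U) (sec X V)) \<and>
     (\<forall>U. openin (mtop X) U \<longrightarrow> (\<forall>s\<in>carrier (sec X U). res X U U s = s)) \<and>
     (\<forall>U V W. openin (mtop X) U \<and> openin (mtop X) V \<and> openin (mtop X) W \<and> W \<subseteq> V \<and> V \<subseteq> U \<longrightarrow>
        (\<forall>s\<in>carrier (sec X U). res X V W (res X U V s) = res X U W s)) \<and>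
     (\<forall>\<U>. (\<forall>V\<in>\<U>. openin (mtop X) V) \<longrightarrow>
        (\<forall>s. (\<forall>V\<in>\<U>. s V \<in> carrier (sec X V)) \<and>
             (\<forall>V\<in>\<U>. \<forall>W\<in>\<U>. res X V (V \<inter> W) (s V) = res X W (V \<inter> W) (s W)) \<longrightarrow>
          (\<exists>!t. t \<in> carrier (sec X (\<Union>\<U>)) \<and> (\<forall>V\<in>\<U>. res X (\<Union>\<U>) V t = s V))))"

definition preim :: "('p, 's) mspace \<Rightarrow> ('p \<Rightarrow> 'q) \<Rightarrow> 'q set \<Rightarrow> 'p set" where
  "preim X f V = {x \<in> topspace (mtop X). f x \<in> V}"

text \<open>
  A morphism \<open>X \<rightarrow> Y\<close> is a continuous map with a map of sheaves \<open>O\<^sub>Y \<rightarrow> f\<^sub>*O\<^sub>X\<close> that is local on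
  stalks. All components are extensional, so that equality of morphisms is equality in the type.
\<close>

type_synonym ('p, 's, 'q, 't) mmor = "('p \<Rightarrow> 'q) \<times> ('q set \<Rightarrow> 't \<Rightarrow> 's)"

definition is_mmor ::
  "('p, 's) mspace \<Rightarrow> ('q, 't) mspace \<Rightarrow> ('p, 's, 'q, 't) mmor \<Rightarrow> bool" where
  "is_mmor X Y m \<longleftrightarrow> (case m of (f, h) \<Rightarrow>
     f \<in> extensional (topspace (mtop X)) \<and> continuous_map (mtop X) (mtop Y) f \<and>
     h \<in> extensional {V. openin (mtop Y) V} \<and>
     (\<forall>V. openin (mtop Y) V \<longrightarrow> h V \<in> hom0 (sec Y V) (sec X (preim X f V))) \<and>
     (\<forall>V W. openin (mtop Y) V \<and> openin (mtop Y) W \<and> W \<subseteq> V \<longrightarrow>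
        (\<forall>t\<in>carrier (sec Y V). h W (res Y V W t) = res X (preim X f V) (preim X f W) (h V t))) \<and>
     (\<forall>x\<in>topspace (mtop X). \<forall>V. openin (mtop Y) V \<and> f x \<in> V \<longrightarrow>
        (\<forall>t\<in>carrier (sec Y V). germ X x (preim X f V) (h V t) \<in> Units (stalk X x) \<longrightarrow>
           germ Y (f x) V t \<in> Units (stalk Y (f x)))))"

text \<open>Composition of \<open>m : X \<rightarrow> Y\<close> with \<open>n : Y \<rightarrow> Z\<close>, and the identity.\<close>

definition mmor_comp :: "('p, 's) mspace \<Rightarrow> ('q, 't) mspace \<Rightarrow> ('r, 'v) mspace \<Rightarrow>
    ('q, 't, 'r, 'v) mmor \<Rightarrow> ('p, 's, 'q, 't) mmor \<Rightarrow> ('p, 's, 'r, 'v) mmor" where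
  "mmor_comp X Y Z n m =
     (compose (topspace (mtop X)) (fst n) (fst m),
      (\<lambda>W\<in>{W. openin (mtop Z) W}.
         compose (carrier (sec Z W)) (snd m (preim Y (fst n) W)) (snd n W)))"

definition mmor_id :: "('p, 's) mspace \<Rightarrow> ('p, 's, 'p, 's) mmor" where
  "mmor_id X = ((\<lambda>x\<in>topspace (mtop X). x),
     (\<lambda>U\<in>{U. openin (mtop X) U}. \<lambda>s\<in>carrier (sec X U). s))"

definition mspace_iso :: "('p, 's) mspace \<Rightarrow> ('q, 't) mspace \<Rightarrow> bool" where
  "mspace_iso X Y \<longleftrightarrow> (\<exists>m n. is_mmor X Y m \<and> is_mmor Y X n \<and>
     mmor_comp X Y X n m = mmor_id X \<and> mmor_comp Y X Y m n = mmor_id Y)"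

definition open_subspace :: "('p, 's) mspace \<Rightarrow> 'p set \<Rightarrow> ('p, 's) mspace" where
  "open_subspace X U = \<lparr>mtop = subtopology (mtop X) U, sec = sec X, res = res X\<rparr>"

definition primes :: "('a, 'z) mon0_scheme \<Rightarrow> 'a set set" where
  "primes A = {P. P \<subseteq> carrier A \<and> mzero A \<in> P \<and> \<one>\<^bsub>A\<^esub> \<notin> P \<and>
     (\<forall>a\<in>carrier A. \<forall>b\<in>P. a \<otimes>\<^bsub>A\<^esub> b \<in> P) \<and>
     (\<forall>a\<in>carrier A. \<forall>b\<in>carrier A. a \<otimes>\<^bsub>A\<^esub> b \<in> P \<longrightarrow> a \<in> P \<or> b \<in> P)}"

definition local_at :: "('a, 'z) mon0_scheme \<Rightarrow> 'a set \<Rightarrow> ('a \<times> 'a) set mon0" where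
  "local_at A P = mon_loc A (carrier A - P)"

definition spec_top :: "('a, 'z) mon0_scheme \<Rightarrow> 'a set topology" where
  "spec_top A = topology_generated_by ((\<lambda>f. {P \<in> primes A. f \<notin> P}) ` carrier A)"

text \<open>Sections over \<open>U\<close> are the functions \<open>P \<mapsto> s(P) \<in> A\<^sub>P\<close> that are locally given by a fraction.\<close>

definition spec_sections ::
  "('a, 'z) mon0_scheme \<Rightarrow> 'a set set \<Rightarrow> ('a set \<Rightarrow> ('a \<times> 'a) set) set" where
  "spec_sections A U = {s \<in> extensional U. \<forall>P\<in>U. \<exists>V. openin (spec_top A) V \<and> P \<in> V \<and> V \<subseteq> U \<and>
     (\<exists>a\<in>carrier A. \<exists>f\<in>carrier A. \<forall>Q\<in>V. f \<notin> Q \<and> s Q = frac A (carrier A - Q) a f)}"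

definition Spec ::
  "('a, 'z) mon0_scheme \<Rightarrow> ('a set, 'a set \<Rightarrow> ('a \<times> 'a) set) mspace" where
  "Spec A = \<lparr>
     mtop = spec_top A,
     sec = (\<lambda>U. \<lparr>carrier = spec_sections A U,
       monoid.mult = (\<lambda>s t. \<lambda>P\<in>U. s P \<otimes>\<^bsub>local_at A P\<^esub> t P),
       one = (\<lambda>P\<in>U. \<one>\<^bsub>local_at A P\<^esub>),
       mzero = (\<lambda>P\<in>U. mzero (local_at A P))\<rparr>),
     res = (\<lambda>U V s. restrict s V)\<rparr>"

definition spec_map :: "'a mon0 \<Rightarrow> 'b mon0 \<Rightarrow> ('a \<Rightarrow> 'b) \<Rightarrow>
    ('b set, 'b set \<Rightarrow> ('b \<times> 'b) set, 'a set, 'a set \<Rightarrow> ('a \<times> 'a) set) mmor" where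
  "spec_map A B \<beta> = (let f = (\<lambda>P\<in>primes B. {a \<in> carrier A. \<beta> a \<in> P}) in
     (f, (\<lambda>V\<in>{V. openin (mtop (Spec A)) V}. \<lambda>s\<in>carrier (sec (Spec A) V).
        \<lambda>P\<in>preim (Spec B) f V. loc_map B (carrier B - P) \<beta> (s (f P)))))"

text \<open>The first argument only fixes the universe of the coordinate monoids of affine charts.\<close>

definition monoidal_scheme :: "'u itself \<Rightarrow> ('p, 's) mspace \<Rightarrow> bool" where
  "monoidal_scheme _ S \<longleftrightarrow> is_mspace S \<and>
     (\<forall>x\<in>topspace (mtop S). \<exists>U. openin (mtop S) U \<and> x \<in> U \<and>
        (\<exists>A :: 'u mon0. is_mon0 A \<and> mspace_iso (open_subspace S U) (Spec A)))"

definition noetherian :: "'u itself \<Rightarrow> ('p, 's) mspace \<Rightarrow> bool" where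
  "noetherian _ S \<longleftrightarrow> (\<exists>\<U>. finite \<U> \<and> \<Union>\<U> = topspace (mtop S) \<and>
     (\<forall>U\<in>\<U>. openin (mtop S) U \<and>
        (\<exists>A :: 'u mon0. is_mon0 A \<and> fin_gen A \<and> mspace_iso (open_subspace S U) (Spec A))))"

type_synonym ('u, 'p, 's) spec_mor = "('u set, 'u set \<Rightarrow> ('u \<times> 'u) set, 'p, 's) mmor"

text \<open>The functor of points \<open>B \<mapsto> Hom(Spec B, S)\<close>.\<close>

definition points ::
  "('p, 's) mspace \<Rightarrow> ('u mon0, 'u \<Rightarrow> 'u, ('u, 'p, 's) spec_mor) set_functor" where
  "points S = \<lparr>
     val = (\<lambda>B. {m. is_mmor (Spec B) S m}),
     act = (\<lambda>B D \<beta> m. mmor_comp (Spec D) (Spec B) S m (spec_map B D \<beta>))\<rparr>"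


section \<open>Classical schemes\<close>

text \<open>\<open>\<phi> : R \<rightarrow> S\<close> exhibits \<open>S\<close> as the localization \<open>R\<^sub>f\<close>.\<close>

definition is_principal_loc :: "'u ring \<Rightarrow> 'u \<Rightarrow> 'u ring \<Rightarrow> ('u \<Rightarrow> 'u) \<Rightarrow> bool" where
  "is_principal_loc R f S \<phi> \<longleftrightarrow> cring S \<and> \<phi> \<in> Rng_hom R S \<and> \<phi> f \<in> Units S \<and>
     (\<forall>y\<in>carrier S. \<exists>a\<in>carrier R. \<exists>n::nat. y \<otimes>\<^bsub>S\<^esub> (\<phi> f [^]\<^bsub>S\<^esub> n) = \<phi> a) \<and>
     (\<forall>a\<in>carrier R. \<phi> a = \<zero>\<^bsub>S\<^esub> \<longrightarrow> (\<exists>n::nat. (f [^]\<^bsub>R\<^esub> n) \<otimes>\<^bsub>R\<^esub> a = \<zero>\<^bsub>R\<^esub>))"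

definition Rng :: "('u ring, 'u \<Rightarrow> 'u) site" where
  "Rng = \<lparr>obj = {R. cring R}, arr = Rng_hom,
     cmp = (\<lambda>R. compose (carrier R)), idt = (\<lambda>R. \<lambda>r\<in>carrier R. r),
     opn = (\<lambda>R S \<phi>. \<exists>f\<in>carrier R. is_principal_loc R f S \<phi>),
     cov = (\<lambda>R K. \<exists>f. (\<forall>k\<in>K. f k \<in> carrier R \<and> is_principal_loc R (f k) (fst k) (snd k)) \<and>
       genideal R (f ` K) = carrier R)\<rparr>"

abbreviation classical_scheme :: "('u ring, 'u \<Rightarrow> 'u, 'q) set_functor \<Rightarrow> bool" where
  "classical_scheme X \<equiv> is_scheme Rng X"


section \<open>The category of pairs and its Zariski site\<close>

text \<open>An object \<open>(A, A \<otimes>\<^bsub>\<bbbF>\<^sub>1\<^esub> \<int> \<rightarrow> R)\<close>.\<close>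

record 'u pair =
  mon :: "'u mon0"
  rng :: "'u ring"
  prj :: "('u \<Rightarrow>\<^sub>0 int) \<Rightarrow> 'u"

definition is_pair :: "'u pair \<Rightarrow> bool" where
  "is_pair X \<longleftrightarrow> is_mon0 (mon X) \<and> cring (rng X) \<and>
     prj X \<in> ring_hom (monoid_ring (mon X)) (rng X) \<and>
     prj X ` carrier (monoid_ring (mon X)) = carrier (rng X)"

text \<open>The adjoint \<open>A \<rightarrow> |R|\<close>.\<close>

definition ev :: "'u pair \<Rightarrow> 'u \<Rightarrow> 'u" where
  "ev X a = prj X (pdelta (mzero (mon X)) a)"

definition is_blueprint :: "'u pair \<Rightarrow> bool" where
  "is_blueprint X \<longleftrightarrow> is_pair X \<and> inj_on (ev X) (carrier (mon X))"

type_synonym 'u dmap = "('u \<Rightarrow> 'u) \<times> ('u \<Rightarrow> 'u)"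

definition Pair :: "('u pair, 'u dmap) category" where
  "Pair = \<lparr>obj = {X. is_pair X},
     arr = (\<lambda>X Y. {(f, g). f \<in> hom0 (mon X) (mon Y) \<and> g \<in> Rng_hom (rng X) (rng Y) \<and>
       (\<forall>c\<in>carrier (monoid_ring (mon X)). g (prj X c) = prj Y (pmap (mzero (mon Y)) f c))}),
     cmp = (\<lambda>X g f. (compose (carrier (mon X)) (fst g) (fst f),
                      compose (carrier (rng X)) (snd g) (snd f))),
     idt = (\<lambda>X. ((\<lambda>a\<in>carrier (mon X). a), (\<lambda>r\<in>carrier (rng X). r)))\<rparr>"

text \<open>
  Modules over a commutative monoid object \<open>(A, R)\<close> in the category of pairs \<open>(X, \<int>[X] \<rightarrow> M)\<close>:
  a pointed set with an action of \<open>A\<close> and an \<open>R\<close>-module, with \<open>\<int>[X] \<rightarrow> M\<close> surjective and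
  compatible with the actions.
\<close>

record 'u pmod =
  pset :: "'u set"
  ppt :: 'u
  pact :: "'u \<Rightarrow> 'u \<Rightarrow> 'u"
  pmd :: "('u, 'u) module"
  pprj :: "('u \<Rightarrow>\<^sub>0 int) \<Rightarrow> 'u"

definition is_pmod :: "'u pair \<Rightarrow> 'u pmod \<Rightarrow> bool" where
  "is_pmod X N \<longleftrightarrow>
     ppt N \<in> pset N \<and>
     (\<forall>a\<in>carrier (mon X). \<forall>x\<in>pset N. pact N a x \<in> pset N) \<and>
     (\<forall>x\<in>pset N. pact N \<one>\<^bsub>mon X\<^esub> x = x \<and> pact N (mzero (mon X)) x = ppt N) \<and>
     (\<forall>a\<in>carrier (mon X). pact N a (ppt N) = ppt N) \<and>
     (\<forall>a\<in>carrier (mon X). \<forall>b\<in>carrier (mon X). \<forall>x\<in>pset N.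
        pact N (a \<otimes>\<^bsub>mon X\<^esub> b) x = pact N a (pact N b x)) \<and>
     Module.module (rng X) (pmd N) \<and>
     (\<forall>c\<in>pfree (pset N) (ppt N). \<forall>d\<in>pfree (pset N) (ppt N).
        pprj N (c + d) = pprj N c \<oplus>\<^bsub>pmd N\<^esub> pprj N d) \<and>
     pprj N ` pfree (pset N) (ppt N) = carrier (pmd N) \<and>
     (\<forall>a\<in>carrier (mon X). \<forall>x\<in>pset N.
        pprj N (pdelta (ppt N) (pact N a x)) = ev X a \<odot>\<^bsub>pmd N\<^esub> pprj N (pdelta (ppt N) x))"

text \<open>Maps \<open>N \<rightarrow> N'\<close> of modules along an arrow \<open>\<phi> : X \<rightarrow> Y\<close> of base objects.\<close>

definition semilinear :: "'u pair \<Rightarrow> 'u dmap \<Rightarrow> 'u pmod \<Rightarrow> 'u pmod \<Rightarrow> 'u dmap set" where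
  "semilinear X \<phi> N N' = {(f, g).
     f \<in> pset N \<rightarrow>\<^sub>E pset N' \<and> f (ppt N) = ppt N' \<and>
     (\<forall>a\<in>carrier (mon X). \<forall>x\<in>pset N. f (pact N a x) = pact N' (fst \<phi> a) (f x)) \<and>
     g \<in> carrier (pmd N) \<rightarrow>\<^sub>E carrier (pmd N') \<and>
     (\<forall>y\<in>carrier (pmd N). \<forall>z\<in>carrier (pmd N). g (y \<oplus>\<^bsub>pmd N\<^esub> z) = g y \<oplus>\<^bsub>pmd N'\<^esub> g z) \<and>
     (\<forall>r\<in>carrier (rng X). \<forall>y\<in>carrier (pmd N). g (r \<odot>\<^bsub>pmd N\<^esub> y) = snd \<phi> r \<odot>\<^bsub>pmd N'\<^esub> g y) \<and>
     (\<forall>c\<in>pfree (pset N) (ppt N). g (pprj N c) = pprj N' (pmap (ppt N') f c))}"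

definition pmod_comp :: "'u pmod \<Rightarrow> 'u dmap \<Rightarrow> 'u dmap \<Rightarrow> 'u dmap" where
  "pmod_comp N k h = (compose (pset N) (fst k) (fst h), compose (carrier (pmd N)) (snd k) (snd h))"

definition Pmod :: "'u pair \<Rightarrow> ('u pmod, 'u dmap) category" where
  "Pmod X = \<lparr>obj = {N. is_pmod X N}, arr = semilinear X (idt Pair X), cmp = pmod_comp,
     idt = (\<lambda>N. ((\<lambda>x\<in>pset N. x), (\<lambda>y\<in>carrier (pmd N). y)))\<rparr>"

text \<open>
  Base change of modules along \<open>\<phi> : X \<rightarrow> Y\<close>, specified up to isomorphism by its universal
  property; \<open>\<eta> : N \<rightarrow> N'\<close> is the unit \<open>n \<mapsto> n \<otimes> 1\<close>.
\<close>

definition is_base_change ::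
  "'u pair \<Rightarrow> 'u pair \<Rightarrow> 'u dmap \<Rightarrow> 'u pmod \<Rightarrow> 'u pmod \<Rightarrow> 'u dmap \<Rightarrow> bool" where
  "is_base_change X Y \<phi> N N' \<eta> \<longleftrightarrow> is_pmod X N \<and> is_pmod Y N' \<and> \<eta> \<in> semilinear X \<phi> N N' \<and>
     (\<forall>P. is_pmod Y P \<longrightarrow> (\<forall>h\<in>semilinear X \<phi> N P.
        (\<exists>!k. k \<in> arr (Pmod Y) N' P \<and> pmod_comp N k \<eta> = h)))"

definition is_base_change_map :: "'u pair \<Rightarrow> 'u pair \<Rightarrow> 'u dmap \<Rightarrow>
    'u pmod \<Rightarrow> 'u pmod \<Rightarrow> 'u dmap \<Rightarrow> 'u pmod \<Rightarrow> 'u pmod \<Rightarrow> 'u dmap \<Rightarrow> bool" where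
  "is_base_change_map X Y \<phi> N P h N' P' h' \<longleftrightarrow>
     (\<exists>\<eta> \<theta>. is_base_change X Y \<phi> N N' \<eta> \<and> is_base_change X Y \<phi> P P' \<theta> \<and>
        h \<in> arr (Pmod X) N P \<and> h' \<in> arr (Pmod Y) N' P' \<and> pmod_comp N h' \<eta> = pmod_comp N \<theta> h)"

text \<open>Flatness: base change preserves finite limits, i.e. the terminal object and pullbacks.\<close>

definition is_flat :: "'u pair \<Rightarrow> 'u pair \<Rightarrow> 'u dmap \<Rightarrow> bool" where
  "is_flat X Y \<phi> \<longleftrightarrow>
     (\<forall>N N' \<eta>. is_terminal (Pmod X) N \<and> is_base_change X Y \<phi> N N' \<eta> \<longrightarrow>
        is_terminal (Pmod Y) N') \<and>
     (\<forall>P A B Z p q f g P' A' B' Z' \<eta>P \<eta>A \<eta>B \<eta>Z p' q' f' g'.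
        is_pullback (Pmod X) P A B Z p q f g \<and>
        is_base_change X Y \<phi> P P' \<eta>P \<and> is_base_change X Y \<phi> A A' \<eta>A \<and>
        is_base_change X Y \<phi> B B' \<eta>B \<and> is_base_change X Y \<phi> Z Z' \<eta>Z \<and>
        p' \<in> arr (Pmod Y) P' A' \<and> pmod_comp P p' \<eta>P = pmod_comp P \<eta>A p \<and>
        q' \<in> arr (Pmod Y) P' B' \<and> pmod_comp P q' \<eta>P = pmod_comp P \<eta>B q \<and>
        f' \<in> arr (Pmod Y) A' Z' \<and> pmod_comp A f' \<eta>A = pmod_comp A \<eta>Z f \<and>
        g' \<in> arr (Pmod Y) B' Z' \<and> pmod_comp B g' \<eta>B = pmod_comp B \<eta>Z g \<longrightarrow>
        is_pullback (Pmod Y) P' A' B' Z' p' q' f' g')"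

definition conservative :: "'u pair \<Rightarrow> ('u pair \<times> 'u dmap) set \<Rightarrow> bool" where
  "conservative X J \<longleftrightarrow> (\<forall>N P h. N \<in> obj (Pmod X) \<and> P \<in> obj (Pmod X) \<and> h \<in> arr (Pmod X) N P \<and>
     (\<forall>(Y, \<phi>)\<in>J. \<forall>N' P' h'. is_base_change_map X Y \<phi> N P h N' P' h' \<longrightarrow>
        is_iso (Pmod Y) N' P' h') \<longrightarrow>
     is_iso (Pmod X) N P h)"

text \<open>
  Finite presentation: \<open>Hom\<^sub>X(Y, -)\<close> commutes with filtered colimits of \<open>X\<close>-algebras, i.e. the
  map from the colimit of the sets \<open>Hom\<^sub>X(Y, D i)\<close> to \<open>Hom\<^sub>X(Y, L)\<close> is surjective and injective.
\<close>

definition finitely_presented :: "'u pair \<Rightarrow> 'u pair \<Rightarrow> 'u dmap \<Rightarrow> bool" where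
  "finitely_presented X Y \<phi> \<longleftrightarrow> (let C = under_category Pair X; T = (Y, \<phi>) in
     \<forall>(I :: ('u, 'u) category) D d L c.
       is_filtered I \<and> is_diagram I C D d \<and> is_colimit I C D d L c \<longrightarrow>
       (\<forall>g\<in>arr C T L. \<exists>i\<in>obj I. \<exists>h\<in>arr C T (D i). cmp C T (c i) h = g) \<and>
       (\<forall>i\<in>obj I. \<forall>j\<in>obj I. \<forall>h\<in>arr C T (D i). \<forall>h'\<in>arr C T (D j).
          cmp C T (c i) h = cmp C T (c j) h' \<longrightarrow>
          (\<exists>k\<in>obj I. \<exists>v\<in>arr I i k. \<exists>w\<in>arr I j k.
             cmp C T (d i k v) h = cmp C T (d j k w) h')))"

definition zariski_open :: "'u pair \<Rightarrow> 'u pair \<Rightarrow> 'u dmap \<Rightarrow> bool" where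
  "zariski_open X Y \<phi> \<longleftrightarrow> Y \<in> obj Pair \<and> \<phi> \<in> arr Pair X Y \<and>
     is_flat X Y \<phi> \<and> is_epi Pair X Y \<phi> \<and> finitely_presented X Y \<phi>"

definition PairSite :: "('u pair, 'u dmap) site" where
  "PairSite = \<lparr>obj = obj Pair, arr = arr Pair, cmp = cmp Pair, idt = idt Pair,
     opn = zariski_open,
     cov = (\<lambda>X K. (\<forall>(Y, \<phi>)\<in>K. zariski_open X Y \<phi>) \<and>
       (\<exists>J\<subseteq>K. finite J \<and> conservative X J))\<rparr>"

definition B_scheme :: "('u pair, 'u dmap, 'v) set_functor \<Rightarrow> bool" where
  "B_scheme \<Sigma> \<longleftrightarrow> is_scheme PairSite \<Sigma> \<and>
     (\<exists>U. affine_zariski_cover PairSite \<Sigma> U \<and> (\<forall>(X, u)\<in>U. is_blueprint X))"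


section \<open>The monoidal scheme and the classical scheme of a \<open>B\<close>-scheme\<close>

text \<open>
  The functor \<open>(A, R) \<mapsto> A\<close> has right adjoint \<open>A \<mapsto> (A, 0)\<close>, and \<open>(A, R) \<mapsto> R\<close> has right adjoint
  \<open>R \<mapsto> (|R|, |R| \<otimes>\<^bsub>\<bbbF>\<^sub>1\<^esub> \<int> \<rightarrow> R)\<close>. The extension of a left adjoint to relative schemes sends a
  sheaf to the sheafification of its precomposition with the right adjoint. For monoids
  sheafification is not needed: every Zariski cover of \<open>Spec A\<close> contains an isomorphism, because
  \<open>A\<close> has a unique maximal ideal.
\<close>

definition trivial_pair :: "'u mon0 \<Rightarrow> 'u pair" where
  "trivial_pair A = (let z = mzero A in
     \<lparr>mon = A,
      rng = \<lparr>carrier = {z}, monoid.mult = (\<lambda>_ _. z), one = z, zero = z, add = (\<lambda>_ _. z)\<rparr>,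
      prj = (\<lambda>_. z)\<rparr>)"

definition trivial_pair_map :: "'u mon0 \<Rightarrow> 'u mon0 \<Rightarrow> ('u \<Rightarrow> 'u) \<Rightarrow> 'u dmap" where
  "trivial_pair_map A B f = (f, (\<lambda>r\<in>{mzero A}. mzero B))"

definition ring_pair :: "'u ring \<Rightarrow> 'u pair" where
  "ring_pair R = \<lparr>mon = forget R, rng = R, prj = monoid_ring_lift R (\<lambda>r. r)\<rparr>"

definition is_monoidal_scheme_of :: "('u pair, 'u dmap, 'v) set_functor \<Rightarrow> ('p, 's) mspace \<Rightarrow>
    ('u mon0 \<Rightarrow> 'v \<Rightarrow> ('u, 'p, 's) spec_mor) \<Rightarrow> bool" where
  "is_monoidal_scheme_of \<Sigma> S \<eta> \<longleftrightarrow> monoidal_scheme TYPE('u) S \<and>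
     is_natural Mon0 (precompose trivial_pair trivial_pair_map \<Sigma>) (points S) \<eta> \<and>
     (\<forall>B\<in>obj Mon0. bij_betw (\<eta> B) (val \<Sigma> (trivial_pair B)) (val (points S) B))"

definition is_classical_scheme_of :: "('u pair, 'u dmap, 'v) set_functor \<Rightarrow>
    ('u ring, 'u \<Rightarrow> 'u, 'q) set_functor \<Rightarrow> ('u ring \<Rightarrow> 'v \<Rightarrow> 'q) \<Rightarrow> bool" where
  "is_classical_scheme_of \<Sigma> X \<tau> \<longleftrightarrow> classical_scheme X \<and>
     is_sheafification Rng (precompose ring_pair (\<lambda>R S f. (f, f)) \<Sigma>) X \<tau>"

definition F1_scheme :: "('p, 's) mspace \<Rightarrow> ('u ring, 'u \<Rightarrow> 'u, 'q) set_functor \<Rightarrow>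
    ('u mon0 \<Rightarrow> ('u, 'p, 's) spec_mor \<Rightarrow> 'q) \<Rightarrow> bool" where
  "F1_scheme S X \<Phi> \<longleftrightarrow> monoidal_scheme TYPE('u) S \<and> classical_scheme X \<and>
     is_natural Mon0 (points S) (precompose free_ring free_ring_map X) \<Phi> \<and>
     (\<forall>K. Ring.field K \<longrightarrow>
        bij_betw (\<lambda>m. act X (free_ring (forget K)) K (counit K) (\<Phi> (forget K) m))
          (val (points S) (forget K)) (val X K))"

text \<open>
  The maps \<open>\<eta>\<close> and \<open>\<tau>\<close> record the identifications of \<open>S\<close> and \<open>\<Sigma>\<^sub>\<int>\<close> with the schemes
  induced by \<open>\<Sigma>\<close>.
\<close>

definition F1_scheme_with_relations :: "('u pair, 'u dmap, 'v) set_functor \<Rightarrow>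
    ('p, 's) mspace \<Rightarrow> ('u mon0 \<Rightarrow> 'v \<Rightarrow> ('u, 'p, 's) spec_mor) \<Rightarrow>
    ('u ring, 'u \<Rightarrow> 'u, 'q) set_functor \<Rightarrow> ('u ring \<Rightarrow> 'v \<Rightarrow> 'q) \<Rightarrow>
    ('u ring, 'u \<Rightarrow> 'u, 'r) set_functor \<Rightarrow>
    ('u mon0 \<Rightarrow> ('u, 'p, 's) spec_mor \<Rightarrow> 'r) \<Rightarrow> bool" where
  "F1_scheme_with_relations \<Sigma> S \<eta> \<Sigma>\<^sub>Z \<tau> \<Sigma>\<^sub>Z' \<Phi> \<longleftrightarrow> B_scheme \<Sigma> \<and>
     is_monoidal_scheme_of \<Sigma> S \<eta> \<and> is_classical_scheme_of \<Sigma> \<Sigma>\<^sub>Z \<tau> \<and> F1_scheme S \<Sigma>\<^sub>Z' \<Phi>"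


section \<open>Homomorphisms from the unit groups of stalks\<close>

text \<open>The monoid \<open>G \<union> {0}\<close>, with \<open>None\<close> as the absorbing element.\<close>

definition adjoin_zero :: "('g, 'z) monoid_scheme \<Rightarrow> 'g option mon0" where
  "adjoin_zero G = \<lparr>carrier = insert None (Some ` carrier G),
     monoid.mult = (\<lambda>a b. case (a, b) of (Some g, Some h) \<Rightarrow> Some (g \<otimes>\<^bsub>G\<^esub> h) | _ \<Rightarrow> None),
     one = Some \<one>\<^bsub>G\<^esub>, mzero = None\<rparr>"

definition mu :: "nat \<Rightarrow> complex monoid" where
  "mu n = \<lparr>carrier = {z. z ^ n = 1}, monoid.mult = (*), one = 1\<rparr>"

text \<open>\<open>Hom(M\<^sup>\<times>, F)\<close> for monoids with zero \<open>M\<close> and \<open>F\<close>.\<close>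

definition unit_homs :: "('a, 'y) mon0_scheme \<Rightarrow> ('b, 'z) mon0_scheme \<Rightarrow> ('a \<Rightarrow> 'b) set" where
  "unit_homs M F = {\<phi> \<in> hom (units_of M) F \<inter> extensional (Units M). \<phi> \<one>\<^bsub>M\<^esub> = \<one>\<^bsub>F\<^esub>}"

text \<open>
  For \<open>j : Spec A \<rightarrow> S\<close> and a prime \<open>P\<close>, the map \<open>O\<^bsub>S,j(P)\<^esub> \<rightarrow> O\<^bsub>Spec A,P\<^esub> = A\<^sub>P\<close> on stalks.
\<close>

definition stalk_map :: "('u, 'p, 's) spec_mor \<Rightarrow> 'u set \<Rightarrow> ('p set \<times> 's) set \<Rightarrow> ('u \<times> 'u) set" where
  "stalk_map j P c = the_elem ((\<lambda>(V, t). snd j V t P) ` c)"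

text \<open>
  \<open>\<psi> : A\<^sub>P \<rightarrow> F\<close> satisfies the relations of \<open>(A, R)\<close> at \<open>P\<close>: the induced ring map
  \<open>A\<^sub>P \<otimes>\<^bsub>\<bbbF>\<^sub>1\<^esub> \<int> \<rightarrow> F \<otimes>\<^bsub>\<bbbF>\<^sub>1\<^esub> \<int>\<close> factors through \<open>A\<^sub>P \<otimes>\<^bsub>\<bbbF>\<^sub>1\<^esub> \<int> \<rightarrow> R\<^sub>P\<close>.
\<close>

definition satisfies_relations ::
  "'u pair \<Rightarrow> 'u set \<Rightarrow> 'b mon0 \<Rightarrow> (('u \<times> 'u) set \<Rightarrow> 'b) \<Rightarrow> bool" where
  "satisfies_relations X P F \<psi> \<longleftrightarrow>
     (let A = mon X; T = ev X ` (carrier A - P); RP = ring_loc (rng X) T in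
      \<exists>\<rho>\<in>ring_hom RP (monoid_ring F). \<forall>c\<in>carrier (monoid_ring (local_at A P)).
        \<rho> (monoid_ring_lift RP (loc_map (rng X) T (ev X)) c) = pmap (mzero F) \<psi> c)"

text \<open>
  \<open>\<Sigma>\<close> is given near \<open>x\<close> by \<open>X = (A, R)\<close> if \<open>u : Spec X \<rightarrow> \<Sigma>\<close> is an affine Zariski open whose
  underlying morphism \<open>j : Spec A \<rightarrow> S\<close> sends some prime \<open>P\<close> to \<open>x\<close>. The Zariski topology of
  pairs also has opens that do not change \<open>A\<close>, e.g. \<open>(A, R) \<rightarrow> (A, 0)\<close>, or \<open>(A, R\<^sub>1)\<close> and
  \<open>(A, R\<^sub>2)\<close> for \<open>R = R\<^sub>1 \<times> R\<^sub>2\<close>, so one asks for the relations of some such open: this is the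
  condition that \<open>\<phi>\<close> comes from a morphism \<open>Spec (F, F \<otimes>\<^bsub>\<bbbF>\<^sub>1\<^esub> \<int>) \<rightarrow> \<Sigma>\<close> at \<open>x\<close>.
\<close>

definition underlying_chart :: "('u pair, 'u dmap, 'v) set_functor \<Rightarrow>
    ('u mon0 \<Rightarrow> 'v \<Rightarrow> ('u, 'p, 's) spec_mor) \<Rightarrow> 'u pair \<Rightarrow> 'v \<Rightarrow> ('u, 'p, 's) spec_mor" where
  "underlying_chart \<Sigma> \<eta> X u = \<eta> (mon X) (act \<Sigma> X (trivial_pair (mon X))
     ((\<lambda>a\<in>carrier (mon X). a), (\<lambda>r\<in>carrier (rng X). mzero (mon X))) u)"

definition unit_homs_B :: "('u pair, 'u dmap, 'v) set_functor \<Rightarrow> ('p, 's) mspace \<Rightarrow>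
    ('u mon0 \<Rightarrow> 'v \<Rightarrow> ('u, 'p, 's) spec_mor) \<Rightarrow> 'p \<Rightarrow> 'b mon0 \<Rightarrow>
    (('p set \<times> 's) set \<Rightarrow> 'b) set" where
  "unit_homs_B \<Sigma> S \<eta> x F = {\<phi> \<in> unit_homs (stalk S x) F.
     \<exists>X u P. zariski_open_immersion PairSite \<Sigma> X u \<and> P \<in> primes (mon X) \<and>
       (let j = underlying_chart \<Sigma> \<eta> X u in fst j P = x \<and>
          satisfies_relations X P F
            (\<lambda>y. if y \<in> Units (local_at (mon X) P)
                 then \<phi> (inv_into (carrier (stalk S x)) (stalk_map j P) y) else mzero F))}"

text \<open>Every finite abelian group is isomorphic to one with carrier in \<open>nat\<close>.\<close>

definition torsion_free :: "('u pair, 'u dmap, 'v) set_functor \<Rightarrow> ('p, 's) mspace \<Rightarrow>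
    ('u mon0 \<Rightarrow> 'v \<Rightarrow> ('u, 'p, 's) spec_mor) \<Rightarrow> bool" where
  "torsion_free \<Sigma> S \<eta> \<longleftrightarrow> (\<forall>x\<in>topspace (mtop S). \<exists>q :: rat poly. \<forall>G :: nat monoid.
     comm_group G \<and> finite (carrier G) \<longrightarrow>
     of_nat (card (unit_homs_B \<Sigma> S \<eta> x (adjoin_zero G))) = poly q (of_nat (card (carrier G))))"

definition P_count :: "('p, 's) mspace \<Rightarrow> nat \<Rightarrow> nat" where
  "P_count S n = (\<Sum>x\<in>topspace (mtop S). card (unit_homs (stalk S x) (adjoin_zero (mu n))))"

definition Q_count :: "('u pair, 'u dmap, 'v) set_functor \<Rightarrow> ('p, 's) mspace \<Rightarrow>
    ('u mon0 \<Rightarrow> 'v \<Rightarrow> ('u, 'p, 's) spec_mor) \<Rightarrow> nat \<Rightarrow> nat" where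
  "Q_count \<Sigma> S \<eta> n =
     (\<Sum>x\<in>topspace (mtop S). card (unit_homs_B \<Sigma> S \<eta> x (adjoin_zero (mu n))))"

end

theory Submission
  imports Defs
begin

text \<open>
  Every point of a noetherian \<open>S\<close> lies in some \<open>Spec A\<close> with \<open>A\<close> finitely generated, and each
  germ \<open>c\<close> there satisfies \<open>c \<cdot> (f/1) = a/1\<close> with \<open>a, f \<in> A\<close> and \<open>f/1\<close> a unit. Since factors of
  units are units, a homomorphism on the units of the stalk is determined by its values on those
  generators of \<open>A\<close> that become units. So each \<open>Hom(O\<^sub>x\<^sup>\<times>, \<bbbF>\<^bsub>1\<^sup>n\<^esub>)\<close> is finite, and its subset
  \<open>Hom\<^sub>B\<close> has at most as many elements. Finiteness is the crux, because the cardinality of an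
  infinite set is \<open>0\<close>.
\<close>

section \<open>Homomorphisms on unit groups\<close>

text \<open>If \<open>c\<close> inverts \<open>a \<otimes> b\<close>, then
  \<open>b \<otimes> c\<close> inverts \<open>a\<close>. Submonoid arguments can therefore be run on
  units alone, and a one-sided inverse is enough for membership in \<open>Units\<close>.\<close>

lemma (in comm_monoid) factor_of_unit:
  assumes "a \<in> carrier G" "b \<in> carrier G" "a \<otimes> b \<in> Units G"
  shows "a \<in> Units G"
proof -
  obtain c where c: "c \<in> carrier G" "c \<otimes> (a \<otimes> b) = \<one>"
    using assms(3) by (auto simp: Units_def)
  have "a \<otimes> (b \<otimes> c) = \<one>" using assms c by (simp add: m_ac)
  moreover have "(b \<otimes> c) \<otimes> a = \<one>" using assms c by (simp add: m_ac)
  ultimately show ?thesis using assms c unfolding Units_def by auto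
qed

lemma unit_homs_mult:
  assumes "\<phi> \<in> unit_homs M F" "c \<in> Units M" "d \<in> Units M"
  shows "\<phi> (c \<otimes>\<^bsub>M\<^esub> d) = \<phi> c \<otimes>\<^bsub>F\<^esub> \<phi> d"
  using assms unfolding unit_homs_def by (auto simp: hom_def units_of_def)

lemma unit_homs_closed:
  assumes "\<phi> \<in> unit_homs M F" "c \<in> Units M"
  shows "\<phi> c \<in> carrier F"
  using assms unfolding unit_homs_def by (auto simp: hom_def units_of_def)

text \<open>A morphism is only asked to land in \<open>F\<close>, which may contain non-invertible
  elements such as an adjoined zero. Since \<open>c\<close> has an inverse, so has its image, and
  such values can be cancelled in \<open>F\<close>.\<close>

lemma unit_homs_Units:
  assumes "comm_monoid M" "comm_monoid F" "\<phi> \<in> unit_homs M F" "c \<in> Units M"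
  shows "\<phi> c \<in> Units F"
proof -
  interpret M: comm_monoid M by fact
  interpret F: comm_monoid F by fact
  have "\<phi> c \<otimes>\<^bsub>F\<^esub> \<phi> (inv\<^bsub>M\<^esub> c) = \<phi> \<one>\<^bsub>M\<^esub>"
    using unit_homs_mult[OF assms(3,4), of "inv\<^bsub>M\<^esub> c"] assms(4) by simp
  also have "\<dots> = \<one>\<^bsub>F\<^esub>" using assms(3) by (simp add: unit_homs_def)
  finally show ?thesis
    using F.factor_of_unit[of "\<phi> c" "\<phi> (inv\<^bsub>M\<^esub> c)"] unit_homs_closed[OF assms(3)] assms(4) by auto
qed

text \<open>Here \<open>g\<close> plays the map from a coordinate monoid to a stalk, and
  \<open>fraction\<close> makes every element of \<open>M\<close> a quotient of two images.
  Restricting a morphism to the finitely many generators with unit image loses nothing, and there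
  are finitely many such restrictions.\<close>

lemma finite_unit_homs:
  fixes A :: "'a mon0" and M :: "'b mon0" and F :: "'c mon0"
  assumes "is_mon0 A" "fin_gen A" "is_mon0 M" "comm_monoid F" "finite (carrier F)"
    and g_closed: "\<And>a. a \<in> carrier A \<Longrightarrow> g a \<in> carrier M"
    and g_mult: "\<And>a b. a \<in> carrier A \<Longrightarrow> b \<in> carrier A \<Longrightarrow> g (a \<otimes>\<^bsub>A\<^esub> b) = g a \<otimes>\<^bsub>M\<^esub> g b"
    and g_one: "g \<one>\<^bsub>A\<^esub> = \<one>\<^bsub>M\<^esub>"
    and g_zero: "g (mzero A) = mzero M"
    and fraction: "\<And>c. c \<in> carrier M \<Longrightarrow>
      \<exists>a\<in>carrier A. \<exists>f\<in>carrier A. g f \<in> Units M \<and> c \<otimes>\<^bsub>M\<^esub> g f = g a"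
  shows "finite (unit_homs M F)"
proof -
  interpret A: comm_monoid A using assms(1) by (simp add: is_mon0_def)
  interpret M: comm_monoid M using assms(3) by (simp add: is_mon0_def)
  interpret F: comm_monoid F by fact
  obtain E where E: "finite E" "E \<subseteq> carrier A"
    and gen: "\<And>T. E \<subseteq> T \<Longrightarrow> \<one>\<^bsub>A\<^esub> \<in> T \<Longrightarrow> mzero A \<in> T \<Longrightarrow> \<forall>a\<in>T. \<forall>b\<in>T. a \<otimes>\<^bsub>A\<^esub> b \<in> T \<Longrightarrow>
      carrier A \<subseteq> T"
    using assms(2) unfolding fin_gen_def by metis
  \<comment> \<open>Generators with non-unit image are dropped: outside \<open>Units M\<close> all
    members of \<open>unit_homs M F\<close> take the same default value.\<close>
  define B where "B = g ` E \<inter> Units M"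
  have "finite B" using E by (simp add: B_def)
  have "inj_on (\<lambda>\<phi>. restrict \<phi> B) (unit_homs M F)"
  proof (rule inj_onI)
    fix \<phi> \<psi> assume \<phi>: "\<phi> \<in> unit_homs M F" and \<psi>: "\<psi> \<in> unit_homs M F"
      and eq: "restrict \<phi> B = restrict \<psi> B"
    have one: "\<phi> \<one>\<^bsub>M\<^esub> = \<psi> \<one>\<^bsub>M\<^esub>" using \<phi> \<psi> by (simp add: unit_homs_def)
    \<comment> \<open>The implication admits elements with non-unit image for free. Closure under
      products then holds because the factors of a unit are units, so the agreement known for each
      factor applies.\<close>
    define T where "T = {a \<in> carrier A. g a \<in> Units M \<longrightarrow> \<phi> (g a) = \<psi> (g a)}"
    have "carrier A \<subseteq> T"
    proof (rule gen)
      show "E \<subseteq> T"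
        using E(2) eq unfolding T_def B_def by (auto simp: restrict_def fun_eq_iff split: if_splits)
      show "\<one>\<^bsub>A\<^esub> \<in> T" using one by (simp add: T_def g_one)
      \<comment> \<open>An invertible zero equals \<open>1\<close>, and both morphisms agree at
        \<open>1\<close>.\<close>
      have "mzero M = \<one>\<^bsub>M\<^esub>" if z: "mzero M \<in> Units M"
      proof -
        have "mzero M \<otimes>\<^bsub>M\<^esub> inv\<^bsub>M\<^esub> (mzero M) = mzero M"
          using assms(3) M.Units_inv_closed[OF z] unfolding is_mon0_def by blast
        then show ?thesis using M.Units_r_inv[OF z] by simp
      qed
      then show "mzero A \<in> T" using one assms(1) by (auto simp: T_def g_zero is_mon0_def)
      show "\<forall>a\<in>T. \<forall>b\<in>T. a \<otimes>\<^bsub>A\<^esub> b \<in> T"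
      proof (intro ballI)
        fix a b assume a: "a \<in> T" and b: "b \<in> T"
        have c: "a \<in> carrier A" "b \<in> carrier A" using a b by (auto simp: T_def)
        have "\<phi> (g (a \<otimes>\<^bsub>A\<^esub> b)) = \<psi> (g (a \<otimes>\<^bsub>A\<^esub> b))" if u: "g (a \<otimes>\<^bsub>A\<^esub> b) \<in> Units M"
        proof -
          have "g a \<in> Units M" "g b \<in> Units M"
            using M.factor_of_unit[of "g a" "g b"] M.factor_of_unit[of "g b" "g a"] u c g_closed
            by (auto simp: g_mult M.m_comm)
          then show ?thesis
            using a b c unit_homs_mult[OF \<phi>] unit_homs_mult[OF \<psi>] by (simp add: T_def g_mult)
        qed
        then show "a \<otimes>\<^bsub>A\<^esub> b \<in> T" using c by (simp add: T_def)
      qed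
    qed
    then have agree: "\<phi> (g a) = \<psi> (g a)" if "a \<in> carrier A" "g a \<in> Units M" for a
      using that by (auto simp: T_def)
    \<comment> \<open>When \<open>c\<close> and \<open>g f\<close> are units, so is
      \<open>g a\<close>, their product. Agreement at \<open>g a\<close> and \<open>g f\<close>
      gives equal products with \<open>\<phi> (g f)\<close>, which is invertible in \<open>F\<close>
      and cancels.\<close>
    have "\<phi> c = \<psi> c" if c: "c \<in> Units M" for c
    proof -
      obtain a f where af: "a \<in> carrier A" "f \<in> carrier A" "g f \<in> Units M" "c \<otimes>\<^bsub>M\<^esub> g f = g a"
        using fraction[of c] c by auto
      then have ga: "g a \<in> Units M" using c M.Units_m_closed by metis
      have "\<phi> c \<otimes>\<^bsub>F\<^esub> \<phi> (g f) = \<psi> c \<otimes>\<^bsub>F\<^esub> \<phi> (g f)"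
        using unit_homs_mult[OF \<phi> c af(3)] unit_homs_mult[OF \<psi> c af(3)]
          agree[OF af(1) ga] agree[OF af(2,3)] af(4) by simp
      then have "\<phi> (g f) \<otimes>\<^bsub>F\<^esub> \<phi> c = \<phi> (g f) \<otimes>\<^bsub>F\<^esub> \<psi> c"
        using unit_homs_closed[OF \<phi>] unit_homs_closed[OF \<psi>] c af(3) by (simp add: F.m_comm)
      moreover have "\<phi> (g f) \<in> Units F"
        by (rule unit_homs_Units[OF M.comm_monoid_axioms F.comm_monoid_axioms \<phi> af(3)])
      ultimately show ?thesis
        using F.Units_l_cancel unit_homs_closed[OF \<phi> c] unit_homs_closed[OF \<psi> c] by metis
    qed
    moreover have "\<phi> \<in> extensional (Units M)" "\<psi> \<in> extensional (Units M)"
      using \<phi> \<psi> by (auto simp: unit_homs_def)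
    ultimately show "\<phi> = \<psi>" by (intro extensionalityI)
  qed
  moreover have "(\<lambda>\<phi>. restrict \<phi> B) ` unit_homs M F \<subseteq> B \<rightarrow>\<^sub>E carrier F"
      proof (rule image_subsetI)
    fix \<phi> assume "\<phi> \<in> unit_homs M F"
    then show "restrict \<phi> B \<in> B \<rightarrow>\<^sub>E carrier F"
      unfolding restrict_PiE_iff B_def by (blast intro: unit_homs_closed)
  qed
  moreover have "finite (B \<rightarrow>\<^sub>E carrier F)"
    using \<open>finite B\<close> assms(5) by (intro finite_PiE)
  ultimately show ?thesis
    by (rule inj_on_finite)
qed


section \<open>Fractions\<close>

locale mult_subset = comm_monoid A for A :: "('a, 'z) monoid_scheme" (structure) +
  fixes T
  assumes sub: "T \<subseteq> carrier A" and one_mem: "\<one> \<in> T"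
    and mult_mem: "s \<in> T \<Longrightarrow> t \<in> T \<Longrightarrow> s \<otimes> t \<in> T"
begin

lemma mem_carrier: "s \<in> T \<Longrightarrow> s \<in> carrier A"
  using sub by auto

text \<open>This is transitivity of the fraction relation, needed because \<open>frac\<close> is the
  set of pairs related to one representative rather than an abstract quotient class.\<close>

lemma frac_subset:
  assumes "a \<in> carrier A" "b \<in> carrier A" "s \<in> T" "t \<in> T" "w \<in> T"
    and w: "w \<otimes> (t \<otimes> a) = w \<otimes> (s \<otimes> b)"
  shows "frac A T a s \<subseteq> frac A T b t"
proof (clarsimp simp: frac_def)
  fix c u v assume c: "c \<in> carrier A" "u \<in> T" "v \<in> T" and v: "v \<otimes> (u \<otimes> a) = v \<otimes> (s \<otimes> c)"
  note mem = c assms(1-5) mem_carrier[OF c(2)] mem_carrier[OF c(3)] mem_carrier[OF assms(3)]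
    mem_carrier[OF assms(4)] mem_carrier[OF assms(5)]
  \<comment> \<open>Without cancellation, both multipliers \<open>w\<close> and \<open>v\<close>
    must be kept, together with the middle denominator \<open>s\<close>, which links the two given
    equations.\<close>
  have "(w \<otimes> v \<otimes> s) \<otimes> (u \<otimes> b) = (v \<otimes> u) \<otimes> (w \<otimes> (s \<otimes> b))" using mem by (simp add: m_ac)
  also have "\<dots> = (w \<otimes> t) \<otimes> (v \<otimes> (u \<otimes> a))" unfolding w[symmetric] using mem by (simp add: m_ac)
  also have "\<dots> = (w \<otimes> v \<otimes> s) \<otimes> (t \<otimes> c)" unfolding v using mem by (simp add: m_ac)
  finally show "\<exists>w\<in>T. w \<otimes> (u \<otimes> b) = w \<otimes> (t \<otimes> c)"
    using mult_mem c(3) assms(3,5) by blast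
qed

lemma frac_eqI:
  assumes "a \<in> carrier A" "b \<in> carrier A" "s \<in> T" "t \<in> T" "w \<in> T"
    and "w \<otimes> (t \<otimes> a) = w \<otimes> (s \<otimes> b)"
  shows "frac A T a s = frac A T b t"
  using frac_subset[OF assms] frac_subset[OF assms(2,1,4,3,5) assms(6)[symmetric]] by blast

lemma frac_self: "a \<in> carrier A \<Longrightarrow> s \<in> T \<Longrightarrow> (a, s) \<in> frac A T a s"
  using one_mem by (auto simp: frac_def)

text \<open>\<open>frac_mult\<close> is a union over all pairs of representatives. Every pair
  contributes the same class, and \<open>frac_self\<close> shows that the union is not
  empty.\<close>

lemma frac_mult_frac:
  assumes "a \<in> carrier A" "b \<in> carrier A" "s \<in> T" "t \<in> T"
  shows "frac_mult A T (frac A T a s) (frac A T b t) = frac A T (a \<otimes> b) (s \<otimes> t)"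
proof -
  have "frac A T (a' \<otimes> b') (s' \<otimes> t') = frac A T (a \<otimes> b) (s \<otimes> t)"
    if a': "(a', s') \<in> frac A T a s" and b': "(b', t') \<in> frac A T b t" for a' s' b' t'
  proof -
    have m: "a' \<in> carrier A" "b' \<in> carrier A" "s' \<in> T" "t' \<in> T"
      using a' b' by (auto simp: frac_def)
    obtain v where v: "v \<in> T" "v \<otimes> (s' \<otimes> a) = v \<otimes> (s \<otimes> a')"
      using a' by (auto simp: frac_def)
    obtain w where w: "w \<in> T" "w \<otimes> (t' \<otimes> b) = w \<otimes> (t \<otimes> b')"
      using b' by (auto simp: frac_def)
    note mem = m assms mem_carrier[OF m(3)] mem_carrier[OF m(4)] mem_carrier[OF assms(3)]
      mem_carrier[OF assms(4)] mem_carrier[OF v(1)] mem_carrier[OF w(1)]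
    have "(v \<otimes> w) \<otimes> ((s \<otimes> t) \<otimes> (a' \<otimes> b')) = (v \<otimes> (s \<otimes> a')) \<otimes> (w \<otimes> (t \<otimes> b'))"
      using mem by (simp add: m_ac)
    also have "\<dots> = (v \<otimes> w) \<otimes> ((s' \<otimes> t') \<otimes> (a \<otimes> b))"
      unfolding v(2)[symmetric] w(2)[symmetric] using mem by (simp add: m_ac)
    finally show ?thesis
      using mem mult_mem v(1) w(1) by (intro frac_eqI[where w = "v \<otimes> w"]) auto
  qed
  then show ?thesis
    using frac_self[OF assms(1,3)] frac_self[OF assms(2,4)] unfolding frac_mult_def by blast
qed

end

lemma mult_subset_prime_compl:
  assumes "is_mon0 A" "P \<in> primes A"
  shows "mult_subset A (carrier A - P)"
proof -
  interpret comm_monoid A using assms(1) by (simp add: is_mon0_def)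
  show ?thesis
    by unfold_locales (use assms(2) in \<open>auto simp: primes_def\<close>)
qed


section \<open>Stalks\<close>

locale monoidal_space =
  fixes X :: "('p, 's) mspace"
  assumes is_mspace: "is_mspace X"
begin

abbreviation op where "op \<equiv> openin (mtop X)"

lemma sec_mon0: "op U \<Longrightarrow> is_mon0 (sec X U)"
  using is_mspace[unfolded is_mspace_def, THEN conjunct1] by blast

lemma sec_comm_monoid: "op U \<Longrightarrow> comm_monoid (sec X U)"
  using sec_mon0 by (simp add: is_mon0_def)

lemma res_hom0: "op U \<Longrightarrow> op V \<Longrightarrow> V \<subseteq> U \<Longrightarrow>
    restrict (res X U V) (carrier (sec X U)) \<in> hom0 (sec X U) (sec X V)"
  using is_mspace[unfolded is_mspace_def, THEN conjunct2, THEN conjunct1] by blast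

lemma res_self: "op U \<Longrightarrow> s \<in> carrier (sec X U) \<Longrightarrow> res X U U s = s"
  using is_mspace[unfolded is_mspace_def, THEN conjunct2, THEN conjunct2, THEN conjunct1] by blast

lemma res_res: "op U \<Longrightarrow> op V \<Longrightarrow> op W \<Longrightarrow> W \<subseteq> V \<Longrightarrow> V \<subseteq> U \<Longrightarrow> s \<in> carrier (sec X U) \<Longrightarrow>
    res X V W (res X U V s) = res X U W s"
  using is_mspace[unfolded is_mspace_def, THEN conjunct2, THEN conjunct2, THEN conjunct2,
    THEN conjunct1] by blast

lemma res_closed:
  assumes "op U" "op V" "V \<subseteq> U" "s \<in> carrier (sec X U)"
  shows "res X U V s \<in> carrier (sec X V)"
  using res_hom0[OF assms(1-3)] assms(4) by (auto simp: hom0_def hom_def Pi_iff)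

lemma res_mult:
  assumes "op U" "op V" "V \<subseteq> U" "s \<in> carrier (sec X U)" "t \<in> carrier (sec X U)"
  shows "res X U V (s \<otimes>\<^bsub>sec X U\<^esub> t) = res X U V s \<otimes>\<^bsub>sec X V\<^esub> res X U V t"
proof -
  \<comment> \<open>Closure under products puts the product in the domain of
    \<open>restrict\<close>, so that the restricted map can be evaluated there.\<close>
  interpret comm_monoid "sec X U" using sec_comm_monoid assms by blast
  show ?thesis using res_hom0[OF assms(1-3)] assms(4,5) by (simp add: hom0_def hom_def)
qed

lemma res_one:
  assumes "op U" "op V" "V \<subseteq> U"
  shows "res X U V \<one>\<^bsub>sec X U\<^esub> = \<one>\<^bsub>sec X V\<^esub>"
proof -
  interpret comm_monoid "sec X U" using sec_comm_monoid assms by blast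
  show ?thesis using res_hom0[OF assms] by (simp add: hom0_def)
qed

lemma res_zero:
  assumes "op U" "op V" "V \<subseteq> U"
  shows "res X U V (mzero (sec X U)) = mzero (sec X V)"
  using res_hom0[OF assms] sec_mon0[OF assms(1)] by (simp add: hom0_def is_mon0_def)

text \<open>Agreement near \<open>x\<close> is transitive: two agreements on \<open>W\<close> and
  \<open>W'\<close> combine on \<open>W \<inter> W'\<close>, which still contains
  \<open>x\<close>.\<close>

lemma germ_subset:
  assumes "op U" "op V" "op W" "x \<in> W" "W \<subseteq> U \<inter> V"
    and s: "s \<in> carrier (sec X U)" and t: "t \<in> carrier (sec X V)"
    and eq: "res X U W s = res X V W t"
  shows "germ X x U s \<subseteq> germ X x V t"
proof (clarsimp simp: germ_def)
  fix V' t' W'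
  assume *: "op V'" "x \<in> V'" "t' \<in> carrier (sec X V')" "op W'" "x \<in> W'" "W' \<subseteq> U" "W' \<subseteq> V'"
    and eq': "res X U W' s = res X V' W' t'"
  have op: "op (W \<inter> W')" using * assms by auto
  have "res X V (W \<inter> W') t = res X W (W \<inter> W') (res X U W s)"
    unfolding eq using * assms op by (subst res_res) auto
  also have "\<dots> = res X W' (W \<inter> W') (res X U W' s)"
    using * assms op by (subst (1 2) res_res) auto
  also have "\<dots> = res X V' (W \<inter> W') t'"
    unfolding eq' using * assms op by (subst res_res) auto
  finally show "\<exists>W. op W \<and> x \<in> W \<and> W \<subseteq> V \<and> W \<subseteq> V' \<and> res X V W t = res X V' W t'"
    using op * assms by (intro exI[of _ "W \<inter> W'"]) auto
qed

lemma germ_eqI: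
  assumes "op U" "op V" "op W" "x \<in> W" "W \<subseteq> U \<inter> V"
    and "s \<in> carrier (sec X U)" "t \<in> carrier (sec X V)" "res X U W s = res X V W t"
  shows "germ X x U s = germ X x V t"
  using germ_subset[OF assms] germ_subset[OF assms(2,1,3,4) _ assms(7,6) assms(8)[symmetric]]
    assms(5) by blast

lemma germ_self:
  assumes "op U" "x \<in> U" "s \<in> carrier (sec X U)"
  shows "(U, s) \<in> germ X x U s"
  using assms by (auto simp: germ_def)

lemma germ_res:
  assumes "op U" "op V" "x \<in> V" "V \<subseteq> U" "s \<in> carrier (sec X U)"
  shows "germ X x V (res X U V s) = germ X x U s"
  using assms by (intro germ_eqI[where W = V]) (auto simp: res_closed res_self)

text \<open>The product in \<open>stalk\<close> is a union over all pairs of representatives, each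
  multiplied on the intersection of its domains. All these products agree near \<open>x\<close>, so
  the stalk product can be computed on one common domain.\<close>

lemma germ_mult:
  assumes "op U" "x \<in> U" "s \<in> carrier (sec X U)" "t \<in> carrier (sec X U)"
  shows "germ X x U s \<otimes>\<^bsub>stalk X x\<^esub> germ X x U t = germ X x U (s \<otimes>\<^bsub>sec X U\<^esub> t)"
proof -
  let ?p = "\<lambda>V s' V' t'. res X V (V \<inter> V') s' \<otimes>\<^bsub>sec X (V \<inter> V')\<^esub> res X V' (V \<inter> V') t'"
  have *: "germ X x (V \<inter> V') (?p V s' V' t') = germ X x U (s \<otimes>\<^bsub>sec X U\<^esub> t)"
    if s': "(V, s') \<in> germ X x U s" and t': "(V', t') \<in> germ X x U t" for V s' V' t'
  proof -
    obtain W where W: "op W" "x \<in> W" "W \<subseteq> U" "W \<subseteq> V" "res X U W s = res X V W s'"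
      and V: "op V" "x \<in> V" "s' \<in> carrier (sec X V)"
      using s' by (auto simp: germ_def)
    obtain W' where W': "op W'" "x \<in> W'" "W' \<subseteq> U" "W' \<subseteq> V'" "res X U W' t = res X V' W' t'"
      and V': "op V'" "x \<in> V'" "t' \<in> carrier (sec X V')"
      using t' by (auto simp: germ_def)
    \<comment> \<open>On \<open>Z\<close> both representatives coincide with \<open>s\<close> and
      \<open>t\<close> at once, so the two products have equal restrictions.\<close>
    define Z where "Z = W \<inter> W'"
    have Z: "op Z" "x \<in> Z" "Z \<subseteq> W" "Z \<subseteq> W'" using W W' by (auto simp: Z_def)
    have VV: "op (V \<inter> V')" "Z \<subseteq> V \<inter> V'" using V V' W W' Z by auto
    have s: "res X V Z s' = res X U Z s"
      using res_res[of U W Z s] res_res[of V W Z s'] W V Z assms by simp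
    have t: "res X V' Z t' = res X U Z t"
      using res_res[of U W' Z t] res_res[of V' W' Z t'] W' V' Z assms by simp
    interpret U: comm_monoid "sec X U" using sec_comm_monoid assms by blast
    interpret VV: comm_monoid "sec X (V \<inter> V')" using sec_comm_monoid VV by blast
    have c: "res X V (V \<inter> V') s' \<in> carrier (sec X (V \<inter> V'))"
      "res X V' (V \<inter> V') t' \<in> carrier (sec X (V \<inter> V'))"
      using V V' VV by (auto intro: res_closed)
    have "res X (V \<inter> V') Z (?p V s' V' t') = res X V Z s' \<otimes>\<^bsub>sec X Z\<^esub> res X V' Z t'"
      using V V' VV Z c by (simp add: res_mult res_res)
    also have "\<dots> = res X U Z (s \<otimes>\<^bsub>sec X U\<^esub> t)"
      using assms Z W by (simp add: res_mult s t)
    finally show ?thesis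
      using assms V V' VV Z W c by (intro germ_eqI[where W = Z]) auto
  qed
  have mem: "(U, s) \<in> germ X x U s" "(U, t) \<in> germ X x U t"
    using assms by (auto intro: germ_self)
  have "germ X x U s \<otimes>\<^bsub>stalk X x\<^esub> germ X x U t =
      (\<Union>(V, s')\<in>germ X x U s. \<Union>(V', t')\<in>germ X x U t. germ X x (V \<inter> V') (?p V s' V' t'))"
    by (simp add: stalk_def)
  also have "\<dots> = germ X x U (s \<otimes>\<^bsub>sec X U\<^esub> t)"
  \<comment> \<open>A nonempty union of equal sets collapses; the rule is applied once for each
    factor.\<close>
  proof (rule SUP_eq_const)
    show "germ X x U s \<noteq> {}" using mem by blast
    fix z assume z: "z \<in> germ X x U s"
    have "(\<Union>(V', t')\<in>germ X x U t. germ X x (fst z \<inter> V') (?p (fst z) (snd z) V' t'))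
        = germ X x U (s \<otimes>\<^bsub>sec X U\<^esub> t)"
    proof (rule SUP_eq_const)
      show "germ X x U t \<noteq> {}" using mem by blast
      fix w assume "w \<in> germ X x U t"
      then show "(case w of (V', t') \<Rightarrow> germ X x (fst z \<inter> V') (?p (fst z) (snd z) V' t'))
          = germ X x U (s \<otimes>\<^bsub>sec X U\<^esub> t)"
        using *[of "fst z" "snd z" "fst w" "snd w"] z by (simp add: case_prod_beta)
    qed
    then show "(case z of (V, s') \<Rightarrow> \<Union>(V', t')\<in>germ X x U t. germ X x (V \<inter> V') (?p V s' V' t'))
        = germ X x U (s \<otimes>\<^bsub>sec X U\<^esub> t)"
      by (simp add: case_prod_beta)
  qed
  finally show ?thesis .
qed

lemma germ_closed:
  assumes "op U" "x \<in> U" "s \<in> carrier (sec X U)"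
  shows "germ X x U s \<in> carrier (stalk X x)"
  using assms by (auto simp: stalk_def)

lemma stalk_cases:
  assumes "c \<in> carrier (stalk X x)"
  obtains U s where "op U" "x \<in> U" "s \<in> carrier (sec X U)" "c = germ X x U s"
  using assms by (auto simp: stalk_def)

text \<open>\<open>stalk\<close> takes its unit from the global sections. Representing it on any
  neighbourhood allows the unit law to be checked in a single monoid of sections.\<close>

lemma germ_one:
  assumes "op U" "x \<in> U"
  shows "germ X x U \<one>\<^bsub>sec X U\<^esub> = \<one>\<^bsub>stalk X x\<^esub>"
proof -
  have U: "U \<subseteq> topspace (mtop X)" using assms openin_subset by blast
  interpret comm_monoid "sec X (topspace (mtop X))" by (intro sec_comm_monoid) simp
  show ?thesis using germ_res[of "topspace (mtop X)" U x "\<one>\<^bsub>sec X (topspace (mtop X))\<^esub>"] assms U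
    by (simp add: stalk_def res_one)
qed

lemma germ_zero:
  assumes "op U" "x \<in> U"
  shows "germ X x U (mzero (sec X U)) = mzero (stalk X x)"
proof -
  have U: "U \<subseteq> topspace (mtop X)" using assms openin_subset by blast
  have "mzero (sec X (topspace (mtop X))) \<in> carrier (sec X (topspace (mtop X)))"
    using sec_mon0[of "topspace (mtop X)"] by (simp add: is_mon0_def)
  then show ?thesis
    using germ_res[of "topspace (mtop X)" U x "mzero (sec X (topspace (mtop X)))"] assms U
    by (simp add: stalk_def res_zero)
qed

text \<open>Three germs are treated together because associativity involves three elements; the
  other laws use fewer.\<close>

lemma common_domain:
  assumes "c \<in> carrier (stalk X x)" "d \<in> carrier (stalk X x)" "e \<in> carrier (stalk X x)"
  obtains W r s t where "op W" "x \<in> W" "r \<in> carrier (sec X W)" "s \<in> carrier (sec X W)"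
    "t \<in> carrier (sec X W)" "c = germ X x W r" "d = germ X x W s" "e = germ X x W t"
proof -
  obtain U r where U: "op U" "x \<in> U" "r \<in> carrier (sec X U)" "c = germ X x U r"
    using stalk_cases[OF assms(1)] .
  obtain V s where V: "op V" "x \<in> V" "s \<in> carrier (sec X V)" "d = germ X x V s"
    using stalk_cases[OF assms(2)] .
  obtain Z t where Z: "op Z" "x \<in> Z" "t \<in> carrier (sec X Z)" "e = germ X x Z t"
    using stalk_cases[OF assms(3)] .
  define W where "W = U \<inter> V \<inter> Z"
  have W: "op W" "x \<in> W" "W \<subseteq> U" "W \<subseteq> V" "W \<subseteq> Z" using U V Z by (auto simp: W_def)
  show thesis
    by (rule that[of W "res X U W r" "res X V W s" "res X Z W t"])
      (use U V Z W in \<open>auto simp: germ_res res_closed\<close>)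
qed

text \<open>Each law is inherited from the monoid of sections over one neighbourhood on which all
  germs involved have representatives.\<close>

lemma is_mon0_stalk:
  assumes x: "x \<in> topspace (mtop X)"
  shows "is_mon0 (stalk X x)"
  unfolding is_mon0_def
proof (intro conjI ballI comm_monoidI)
  let ?T = "topspace (mtop X)"
  have T: "op ?T" by simp
  interpret T: comm_monoid "sec X ?T" using sec_comm_monoid[OF T] .
  show one: "\<one>\<^bsub>stalk X x\<^esub> \<in> carrier (stalk X x)"
    using germ_closed[OF T x, of "\<one>\<^bsub>sec X ?T\<^esub>"] germ_one[OF T x] by simp
  show zero: "mzero (stalk X x) \<in> carrier (stalk X x)"
    using germ_closed[OF T x, of "mzero (sec X ?T)"] germ_zero[OF T x] sec_mon0[OF T]
    by (simp add: is_mon0_def)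
  fix c assume c: "c \<in> carrier (stalk X x)"
  obtain W r where W: "op W" "x \<in> W" "r \<in> carrier (sec X W)" "c = germ X x W r"
    using stalk_cases[OF c] .
  interpret W: comm_monoid "sec X W" using sec_comm_monoid[OF W(1)] .
  show "\<one>\<^bsub>stalk X x\<^esub> \<otimes>\<^bsub>stalk X x\<^esub> c = c"
    using W by (simp add: germ_mult flip: germ_one[OF W(1,2)])
  show "mzero (stalk X x) \<otimes>\<^bsub>stalk X x\<^esub> c = mzero (stalk X x)"
    using W sec_mon0[OF W(1)] by (simp add: germ_mult is_mon0_def flip: germ_zero[OF W(1,2)])
  fix d assume d: "d \<in> carrier (stalk X x)"
  fix e assume e: "e \<in> carrier (stalk X x)"
  obtain V r s t where V: "op V" "x \<in> V" "r \<in> carrier (sec X V)" "s \<in> carrier (sec X V)"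
    "t \<in> carrier (sec X V)" "c = germ X x V r" "d = germ X x V s" "e = germ X x V t"
    using common_domain[OF c d e] .
  interpret V: comm_monoid "sec X V" using sec_comm_monoid[OF V(1)] .
  show "c \<otimes>\<^bsub>stalk X x\<^esub> d \<otimes>\<^bsub>stalk X x\<^esub> e = c \<otimes>\<^bsub>stalk X x\<^esub> (d \<otimes>\<^bsub>stalk X x\<^esub> e)"
    using V by (simp add: germ_mult V.m_assoc)
  show "c \<otimes>\<^bsub>stalk X x\<^esub> d = d \<otimes>\<^bsub>stalk X x\<^esub> c"
    using V by (simp add: germ_mult V.m_comm)
  show "c \<otimes>\<^bsub>stalk X x\<^esub> d \<in> carrier (stalk X x)"
    using V by (simp add: germ_mult germ_closed)
qed

end


section \<open>Affine charts\<close>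

lemma topspace_spec_top:
  assumes "is_mon0 A"
  shows "topspace (spec_top A) = primes A"
proof -
  interpret comm_monoid A using assms by (simp add: is_mon0_def)
  \<comment> \<open>A prime never contains \<open>1\<close>, so the basic open set of
    \<open>1\<close> is the whole spectrum.\<close>
  show ?thesis
    by (auto simp: spec_top_def topology_generated_by_topspace primes_def intro!: bexI[of _ "\<one>\<^bsub>A\<^esub>"])
qed

text \<open>The section \<open>a/f\<close> over \<open>V\<close>. It is cut off outside
  \<open>V\<close> because \<open>spec_sections\<close> consists of extensional functions.\<close>

definition frac_sec :: "('a, 'z) mon0_scheme \<Rightarrow> 'a set set \<Rightarrow> 'a \<Rightarrow> 'a \<Rightarrow> 'a set \<Rightarrow> ('a \<times> 'a) set"
  where "frac_sec A V a f = (\<lambda>P\<in>V. frac A (carrier A - P) a f)"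

lemma frac_sec_closed:
  assumes "openin (spec_top A) V" "a \<in> carrier A" "f \<in> carrier A" "\<And>P. P \<in> V \<Longrightarrow> f \<notin> P"
  shows "frac_sec A V a f \<in> carrier (sec (Spec A) V)"
  using assms by (auto simp: frac_sec_def Spec_def spec_sections_def)

lemma res_frac_sec: "W \<subseteq> V \<Longrightarrow> res (Spec A) V W (frac_sec A V a f) = frac_sec A W a f"
  by (auto simp: frac_sec_def Spec_def restrict_def fun_eq_iff)

lemma frac_sec_one: "\<one>\<^bsub>sec (Spec A) V\<^esub> = frac_sec A V \<one>\<^bsub>A\<^esub> \<one>\<^bsub>A\<^esub>"
  by (simp add: frac_sec_def Spec_def local_at_def mon_loc_def)

lemma frac_sec_zero: "mzero (sec (Spec A) V) = frac_sec A V (mzero A) \<one>\<^bsub>A\<^esub>"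
  by (simp add: frac_sec_def Spec_def local_at_def mon_loc_def)

lemma frac_sec_mult:
  assumes "is_mon0 A" "V \<subseteq> primes A" "a \<in> carrier A" "f \<in> carrier A" "b \<in> carrier A" "g \<in> carrier A"
    and "\<And>P. P \<in> V \<Longrightarrow> f \<notin> P \<and> g \<notin> P"
  shows "frac_sec A V a f \<otimes>\<^bsub>sec (Spec A) V\<^esub> frac_sec A V b g = frac_sec A V (a \<otimes>\<^bsub>A\<^esub> b) (f \<otimes>\<^bsub>A\<^esub> g)"
proof -
  have "frac_mult A (carrier A - P) (frac A (carrier A - P) a f) (frac A (carrier A - P) b g)
      = frac A (carrier A - P) (a \<otimes>\<^bsub>A\<^esub> b) (f \<otimes>\<^bsub>A\<^esub> g)" if P: "P \<in> V" for P
  proof -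
    interpret mult_subset A "carrier A - P"
      using mult_subset_prime_compl assms(1,2) P by blast
    show ?thesis using assms P by (intro frac_mult_frac) auto
  qed
  then show ?thesis
    by (auto simp: frac_sec_def Spec_def local_at_def mon_loc_def fun_eq_iff)
qed

text \<open>An equality of cross products in \<open>A\<close> itself holds in every localization,
  with multiplier \<open>1\<close>.\<close>

lemma frac_sec_cong:
  assumes "is_mon0 A" "V \<subseteq> primes A" "a \<in> carrier A" "f \<in> carrier A" "b \<in> carrier A" "g \<in> carrier A"
    and "\<And>P. P \<in> V \<Longrightarrow> f \<notin> P \<and> g \<notin> P" and "g \<otimes>\<^bsub>A\<^esub> a = f \<otimes>\<^bsub>A\<^esub> b"
  shows "frac_sec A V a f = frac_sec A V b g"
proof -
  have "frac A (carrier A - P) a f = frac A (carrier A - P) b g" if P: "P \<in> V" for P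
  proof -
    interpret mult_subset A "carrier A - P"
      using mult_subset_prime_compl assms(1,2) P by blast
    show ?thesis using assms P by (intro frac_eqI[where w = "\<one>\<^bsub>A\<^esub>"]) (auto simp: one_mem[simplified])
  qed
  then show ?thesis by (auto simp: frac_sec_def fun_eq_iff)
qed

section \<open>Finiteness of the set of morphisms on the units of a stalk\<close>

text \<open>The abstract finiteness lemma is applied to the canonical map from \<open>A\<close> to
  the stalk. Its fraction hypothesis is obtained by moving a section to \<open>Spec A\<close>, where
  it is locally a fraction, and pulling that fraction back.\<close>

lemma finite_unit_homs_stalk:
  fixes S :: "('p, 's) mspace" and A :: "'u mon0" and F :: "'c mon0"
  assumes S: "is_mspace S" and U: "openin (mtop S) U" and x: "x \<in> U"
    and A: "is_mon0 A" "fin_gen A" and iso: "mspace_iso (open_subspace S U) (Spec A)"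
    and F: "comm_monoid F" "finite (carrier F)"
  shows "finite (unit_homs (stalk S x) F)"
proof -
  interpret monoidal_space S by unfold_locales fact
  interpret A: comm_monoid A using A by (simp add: is_mon0_def)
  let ?X = "open_subspace S U"
  let ?D = "primes A"
  have top: "topspace (mtop ?X) = U" and open_iff: "openin (mtop ?X) V \<longleftrightarrow> op V \<and> V \<subseteq> U" for V
    using U openin_subset[OF U] openin_open_subtopology[OF U]
    by (auto simp: open_subspace_def)
  have sec: "sec ?X = sec S" "res ?X = res S" by (simp_all add: open_subspace_def)
  have topA: "topspace (mtop (Spec A)) = ?D" and mtopA: "mtop (Spec A) = spec_top A"
    using topspace_spec_top[OF A(1)] by (simp_all add: Spec_def)
  \<comment> \<open>The pair \<open>(f, h)\<close> goes from the open subspace to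
    \<open>Spec A\<close>, and \<open>(k, l)\<close> goes back. As sections pull back
    contravariantly, \<open>inv\<close> says that \<open>k\<close> after \<open>f\<close> is the
    identity on points and \<open>h\<close> after \<open>l\<close> the identity on sections.\<close>
  obtain f h k l where m: "is_mmor ?X (Spec A) (f, h)" and n: "is_mmor (Spec A) ?X (k, l)"
    and inv: "mmor_comp ?X (Spec A) ?X (k, l) (f, h) = mmor_id ?X"
    using iso unfolding mspace_iso_def by (metis surj_pair)
  have f: "continuous_map (mtop ?X) (mtop (Spec A)) f"
    and h: "\<And>V. openin (spec_top A) V \<Longrightarrow> h V \<in> hom0 (sec (Spec A) V) (sec S (preim ?X f V))"
    and h_nat: "\<And>V W t. openin (spec_top A) V \<Longrightarrow> openin (spec_top A) W \<Longrightarrow> W \<subseteq> V \<Longrightarrow>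
      t \<in> carrier (sec (Spec A) V) \<Longrightarrow>
      h W (res (Spec A) V W t) = res S (preim ?X f V) (preim ?X f W) (h V t)"
    using m unfolding is_mmor_def by (auto simp: sec mtopA)
  have k: "continuous_map (mtop (Spec A)) (mtop ?X) k"
    and l: "\<And>V. op V \<Longrightarrow> V \<subseteq> U \<Longrightarrow> l V \<in> hom0 (sec S V) (sec (Spec A) (preim (Spec A) k V))"
    using n unfolding is_mmor_def by (auto simp: sec open_iff)
  have kf: "k (f y) = y" if "y \<in> U" for y
  proof -
    have "compose (topspace (mtop ?X)) k f = (\<lambda>x\<in>topspace (mtop ?X). x)"
      using inv unfolding mmor_comp_def mmor_id_def by simp
    then show ?thesis using that unfolding top by (metis compose_eq restrict_apply')
  qed
  have hl: "h (preim (Spec A) k V) (l V s) = s"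
    if V: "op V" "V \<subseteq> U" "s \<in> carrier (sec S V)" for V s
  proof -
    have "(\<lambda>W\<in>{W. openin (mtop ?X) W}. compose (carrier (sec ?X W)) (h (preim (Spec A) k W)) (l W))
        = (\<lambda>W\<in>{W. openin (mtop ?X) W}. \<lambda>s\<in>carrier (sec ?X W). s)"
      using inv unfolding mmor_comp_def mmor_id_def by simp
    from fun_cong[OF this, of V] have
      "compose (carrier (sec S V)) (h (preim (Spec A) k V)) (l V) = (\<lambda>s\<in>carrier (sec S V). s)"
      using V by (simp add: sec open_iff)
    then show ?thesis using V(3) by (metis compose_eq restrict_apply')
  qed
  have f_prime: "f y \<in> ?D" if "y \<in> U" for y
    using continuous_map_image_subset_topspace[OF f] that unfolding top topA by auto
  have preim_open: "op (preim ?X f V) \<and> preim ?X f V \<subseteq> U" if "openin (spec_top A) V" for V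
    using openin_continuous_map_preimage[OF f, of V] that
    unfolding preim_def by (simp add: open_iff mtopA)
  have preim_open': "openin (spec_top A) (preim (Spec A) k V)" if "op V" "V \<subseteq> U" for V
    using openin_continuous_map_preimage[OF k, of V] that
    unfolding preim_def by (simp add: open_iff mtopA)
  have D: "openin (spec_top A) ?D" using topspace_spec_top[OF A(1)] openin_topspace by metis
  have preim_D: "preim ?X f ?D = U" using f_prime by (auto simp: preim_def top)
  have no_one: "\<And>P. P \<in> ?D \<Longrightarrow> \<one>\<^bsub>A\<^esub> \<notin> P" by (simp add: primes_def)
  have sec_mem: "frac_sec A ?D a \<one>\<^bsub>A\<^esub> \<in> carrier (sec (Spec A) ?D)" if "a \<in> carrier A" for a
    using frac_sec_closed[OF D that] no_one by simp
  \<comment> \<open>This is the canonical map to the stalk at \<open>x\<close>: the global section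
    \<open>a/1\<close> is pulled back to \<open>U\<close>, then its germ is taken.\<close>
  define g where "g a = germ S x U (h ?D (frac_sec A ?D a \<one>\<^bsub>A\<^esub>))" for a
  have hD: "h ?D \<in> hom0 (sec (Spec A) ?D) (sec S U)" using h[OF D] by (simp add: preim_D)
  have h_closed: "h ?D (frac_sec A ?D a \<one>\<^bsub>A\<^esub>) \<in> carrier (sec S U)" if "a \<in> carrier A" for a
    using hD sec_mem[OF that] by (auto simp: hom0_def hom_def)
  \<comment> \<open>The germ may be computed over any neighbourhood of \<open>f x\<close>. This
    permits comparison with fractions whose denominator is invertible only locally.\<close>
  have g_eq: "g a = germ S x (preim ?X f V) (h V (frac_sec A V a \<one>\<^bsub>A\<^esub>))"
    if a: "a \<in> carrier A" and V: "openin (spec_top A) V" "f x \<in> V" for a V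
  proof -
    have VD: "V \<subseteq> ?D" using openin_subset[OF V(1)] topspace_spec_top[OF A(1)] by simp
    have W: "op (preim ?X f V)" "preim ?X f V \<subseteq> U" "x \<in> preim ?X f V"
      using preim_open[OF V(1)] x V(2) by (auto simp: preim_def top)
    have "h V (frac_sec A V a \<one>\<^bsub>A\<^esub>) = res S U (preim ?X f V) (h ?D (frac_sec A ?D a \<one>\<^bsub>A\<^esub>))"
      using h_nat[OF D V(1) VD sec_mem[OF a]] by (simp add: res_frac_sec[OF VD] preim_D)
    then show ?thesis
      unfolding g_def using germ_res[OF U W(1,3,2) h_closed[OF a]] by simp
  qed
  show ?thesis
  proof (rule finite_unit_homs[OF A _ F])
    show "is_mon0 (stalk S x)" using is_mon0_stalk x openin_subset[OF U] by blast
    show "g a \<in> carrier (stalk S x)" if "a \<in> carrier A" for a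
      unfolding g_def using germ_closed[OF U x h_closed[OF that]] .
    show "g (a \<otimes>\<^bsub>A\<^esub> b) = g a \<otimes>\<^bsub>stalk S x\<^esub> g b" if "a \<in> carrier A" "b \<in> carrier A" for a b
    proof -
      have "frac_sec A ?D (a \<otimes>\<^bsub>A\<^esub> b) \<one>\<^bsub>A\<^esub>
          = frac_sec A ?D a \<one>\<^bsub>A\<^esub> \<otimes>\<^bsub>sec (Spec A) ?D\<^esub> frac_sec A ?D b \<one>\<^bsub>A\<^esub>"
        using that no_one by (subst frac_sec_mult[OF A(1)]) auto
      then show ?thesis
        unfolding g_def using hD sec_mem[OF that(1)] sec_mem[OF that(2)]
        by (simp add: germ_mult[OF U x h_closed[OF that(1)] h_closed[OF that(2)]] hom0_def hom_def)
    qed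
    show "g \<one>\<^bsub>A\<^esub> = \<one>\<^bsub>stalk S x\<^esub>"
      unfolding g_def using hD germ_one[OF U x] by (simp add: hom0_def frac_sec_one)
    show "g (mzero A) = mzero (stalk S x)"
      unfolding g_def using hD germ_zero[OF U x] by (simp add: hom0_def frac_sec_zero)
    fix c assume c: "c \<in> carrier (stalk S x)"
    obtain V0 s0 where V0: "op V0" "x \<in> V0" "s0 \<in> carrier (sec S V0)" "c = germ S x V0 s0"
      using stalk_cases[OF c] .
    \<comment> \<open>The representative is shrunk into \<open>U\<close>, where the chart is
      available.\<close>
    define V where "V = V0 \<inter> U"
    define s where "s = res S V0 V s0"
    have V: "op V" "x \<in> V" "V \<subseteq> U" and sub: "V \<subseteq> V0" using V0 U x by (auto simp: V_def)
    have s: "s \<in> carrier (sec S V)" and c_eq: "c = germ S x V s"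
      using V0 res_closed[OF V0(1) V(1) sub V0(3)] germ_res[OF V0(1) V(1,2) sub V0(3)]
      by (auto simp: s_def)
    let ?V' = "preim (Spec A) k V"
    have V': "openin (spec_top A) ?V'" using preim_open' V by blast
    have preim': "preim ?X f ?V' = V"
      using kf V(3) f_prime by (auto simp: preim_def top topA)
    have ls: "l V s \<in> carrier (sec (Spec A) ?V')"
      using l[OF V(1,3)] s by (auto simp: hom0_def hom_def)
    \<comment> \<open>By definition, sections of \<open>Spec A\<close> are locally single fractions;
      this is used at the point \<open>f x\<close>.\<close>
    have "\<forall>P\<in>?V'. \<exists>W. openin (spec_top A) W \<and> P \<in> W \<and> W \<subseteq> ?V' \<and>
        (\<exists>a\<in>carrier A. \<exists>d\<in>carrier A. \<forall>Q\<in>W. d \<notin> Q \<and> l V s Q = frac A (carrier A - Q) a d)"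
      using ls by (simp add: Spec_def spec_sections_def)
    moreover have "f x \<in> ?V'" using kf x f_prime V(2) by (auto simp: preim_def topA)
    ultimately obtain W a d where W: "openin (spec_top A) W" "f x \<in> W" "W \<subseteq> ?V'"
      and ad: "a \<in> carrier A" "d \<in> carrier A"
      and frac: "\<And>Q. Q \<in> W \<Longrightarrow> d \<notin> Q \<and> l V s Q = frac A (carrier A - Q) a d"
      by meson
    let ?W = "preim ?X f W"
    have W': "op ?W" "x \<in> ?W" using preim_open[OF W(1)] W(2) x by (auto simp: preim_def top)
    have WV: "?W \<subseteq> V" using W(3) preim' by (auto simp: preim_def)
    have WD: "W \<subseteq> ?D" using openin_subset[OF W(1)] topspace_spec_top[OF A(1)] by simp
    have no_one_W: "\<And>P. P \<in> W \<Longrightarrow> \<one>\<^bsub>A\<^esub> \<notin> P" using WD no_one by blast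
    have hW: "h W \<in> hom0 (sec (Spec A) W) (sec S ?W)" by (rule h[OF W(1)])
    have hW_closed: "h W t \<in> carrier (sec S ?W)" if "t \<in> carrier (sec (Spec A) W)" for t
      using hW that by (auto simp: hom0_def hom_def)
    have hW_mult: "h W (t \<otimes>\<^bsub>sec (Spec A) W\<^esub> u) = h W t \<otimes>\<^bsub>sec S ?W\<^esub> h W u"
      if "t \<in> carrier (sec (Spec A) W)" "u \<in> carrier (sec (Spec A) W)" for t u
      using hW that by (simp add: hom0_def hom_def)
    have "res (Spec A) ?V' W (l V s) = frac_sec A W a d"
      using frac by (auto simp: Spec_def frac_sec_def fun_eq_iff)
    \<comment> \<open>Naturality of \<open>h\<close> moves the restriction to \<open>W\<close>
      across the pullback, and \<open>hl\<close> turns the pullback of \<open>l V s\<close> into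
      \<open>s\<close> again.\<close>
    then have "res S V ?W s = h W (frac_sec A W a d)"
      using h_nat[OF V' W(1,3) ls] hl[OF V(1,3) s] preim' by simp
    then have c_W: "c = germ S x ?W (h W (frac_sec A W a d))"
      using germ_res[OF V(1) W'(1,2) WV s] c_eq by simp
    have m: "frac_sec A W a d \<in> carrier (sec (Spec A) W)"
        "frac_sec A W d \<one>\<^bsub>A\<^esub> \<in> carrier (sec (Spec A) W)"
        "frac_sec A W \<one>\<^bsub>A\<^esub> d \<in> carrier (sec (Spec A) W)"
      using ad frac no_one_W W(1) by (auto intro!: frac_sec_closed)
    \<comment> \<open>Over \<open>W\<close> the denominator \<open>d\<close> is invertible, so
      \<open>a/d\<close> times \<open>d/1\<close> is \<open>a/1\<close>, and \<open>d/1\<close>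
      times \<open>1/d\<close> is \<open>1\<close>. Pulled back along \<open>h W\<close>, the first
      identity yields \<open>eq\<close> and the second makes \<open>g d\<close> a unit.\<close>
    have 1: "frac_sec A W a d \<otimes>\<^bsub>sec (Spec A) W\<^esub> frac_sec A W d \<one>\<^bsub>A\<^esub> = frac_sec A W a \<one>\<^bsub>A\<^esub>"
      using ad frac no_one_W WD A(1)
      by (subst frac_sec_mult) (auto intro!: frac_sec_cong simp: A.m_comm)
    have 2: "frac_sec A W d \<one>\<^bsub>A\<^esub> \<otimes>\<^bsub>sec (Spec A) W\<^esub> frac_sec A W \<one>\<^bsub>A\<^esub> d = \<one>\<^bsub>sec (Spec A) W\<^esub>"
      unfolding frac_sec_one using ad frac no_one_W WD A(1)
      by (subst frac_sec_mult) (auto intro!: frac_sec_cong)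
    have g_d: "g d = germ S x ?W (h W (frac_sec A W d \<one>\<^bsub>A\<^esub>))" by (rule g_eq[OF ad(2) W(1,2)])
    have eq: "c \<otimes>\<^bsub>stalk S x\<^esub> g d = g a"
      unfolding c_W g_d g_eq[OF ad(1) W(1,2)] using m
      by (simp add: germ_mult[OF W'] hW_closed flip: hW_mult 1)
    interpret st: comm_monoid "stalk S x"
      using is_mon0_stalk x openin_subset[OF U] by (auto simp: is_mon0_def)
    have "g d \<otimes>\<^bsub>stalk S x\<^esub> germ S x ?W (h W (frac_sec A W \<one>\<^bsub>A\<^esub> d)) = \<one>\<^bsub>stalk S x\<^esub>"
      unfolding g_d using m hW 2
      by (simp add: germ_mult[OF W'] hW_closed germ_one[OF W'] hom0_def flip: hW_mult)
    then have "g d \<in> Units (stalk S x)"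
      using st.factor_of_unit[of "g d" "germ S x ?W (h W (frac_sec A W \<one>\<^bsub>A\<^esub> d))"] m
      by (simp add: g_d germ_closed[OF W'] hW_closed)
    with eq ad show "\<exists>a\<in>carrier A. \<exists>f\<in>carrier A. g f \<in> Units (stalk S x) \<and> c \<otimes>\<^bsub>stalk S x\<^esub> g f = g a"
      by blast
  qed
qed

section \<open>Roots of unity and comparison of the two sums\<close>

lemma comm_monoid_adjoin_zero:
  assumes "comm_monoid G"
  shows "comm_monoid (adjoin_zero G)"
proof -
  interpret comm_monoid G by fact
  show ?thesis
    by (rule comm_monoidI) (auto simp: adjoin_zero_def m_ac)
qed

lemma comm_monoid_mu: "comm_monoid (mu n)"
  by (rule comm_monoidI) (auto simp: mu_def power_mult_distrib)

text \<open>The bound matters: for \<open>n = 0\<close> every complex number satisfies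
  \<open>z ^ n = 1\<close>.\<close>

lemma finite_mu: "n \<ge> 1 \<Longrightarrow> finite (carrier (mu n))"
  using finite_roots_unity[of n, where 'a = complex] by (simp add: mu_def)

theorem proposition5p14:
  fixes \<Sigma> :: "('u pair, 'u dmap, 'v) set_functor"
    and S :: "('p, 's) mspace"
    and \<eta> :: "'u mon0 \<Rightarrow> 'v \<Rightarrow> ('u, 'p, 's) spec_mor"
    and \<Sigma>\<^sub>Z :: "('u ring, 'u \<Rightarrow> 'u, 'q) set_functor"
    and \<tau> :: "'u ring \<Rightarrow> 'v \<Rightarrow> 'q"
    and \<Sigma>\<^sub>Z' :: "('u ring, 'u \<Rightarrow> 'u, 'r) set_functor"
    and \<Phi> :: "'u mon0 \<Rightarrow> ('u, 'p, 's) spec_mor \<Rightarrow> 'r"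
    and n :: nat
  assumes "infinite (UNIV :: 'u set)"
    and "F1_scheme_with_relations \<Sigma> S \<eta> \<Sigma>\<^sub>Z \<tau> \<Sigma>\<^sub>Z' \<Phi>"
    and "noetherian TYPE('u) S"
    and "torsion_free \<Sigma> S \<eta>"
    and "n \<ge> 1"
  shows "Q_count \<Sigma> S \<eta> n \<le> P_count S n"
proof -
  have S: "is_mspace S"
    using assms(2) by (simp add: F1_scheme_with_relations_def F1_scheme_def monoidal_scheme_def)
  have "card (unit_homs_B \<Sigma> S \<eta> x (adjoin_zero (mu n))) \<le> card (unit_homs (stalk S x) (adjoin_zero (mu n)))"
    if x: "x \<in> topspace (mtop S)" for x
  proof (rule card_mono)
    \<comment> \<open>The chart through \<open>x\<close> is taken from the noetherian cover, since
      the charts in \<open>monoidal_scheme\<close> may have coordinate monoids that are not finitely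
      generated.\<close>
    obtain U and A :: "'u mon0" where "x \<in> U" "openin (mtop S) U" "is_mon0 A" "fin_gen A"
      "mspace_iso (open_subspace S U) (Spec A)"
      using assms(3) x unfolding noetherian_def by (metis UnionE)
    moreover have "finite (carrier (adjoin_zero (mu n)))"
      using finite_mu[OF assms(5)] by (simp add: adjoin_zero_def)
    ultimately show "finite (unit_homs (stalk S x) (adjoin_zero (mu n)))"
      using finite_unit_homs_stalk[OF S] comm_monoid_adjoin_zero[OF comm_monoid_mu] by blast
    show "unit_homs_B \<Sigma> S \<eta> x (adjoin_zero (mu n)) \<subseteq> unit_homs (stalk S x) (adjoin_zero (mu n))"
      by (auto simp: unit_homs_B_def)
  qed
  then show ?thesis
    unfolding Q_count_def P_count_def by (rule sum_mono)
qed

end
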